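(* Let $\delta,\epsilon\in\mathbb{R}$ be fixed. For each integer $N\ge 1$ let the coupling $J=J_N\in\mathbb{R}$, the interaction strength $U=U_N\in\mathbb{R}$ and the temperature $T=T_N>0$ be such that $NJ/(k_BT)=\delta$ and $N^2U/(2k_BT)=\epsilon$. Let $\tilde P_{N,T}$ be the normalized Husimi distribution of the canonical equilibrium ensemble, at temperature $T$, of the two-site Bose-Hubbard Hamiltonian on the $N$-boson space. Then, in the limit $N\to\infty$ with $\delta$ and $\epsilon$ held constant, $\tilde P_{N,T}$ converges pointwise on the unit sphere: for every $\theta\in[0,\pi]$ and $\phi\in[0,2\pi)$, $$\lim_{N\to\infty}\tilde P_{N,T}(\theta,\phi)=\frac{1}{\mathcal N}\exp\!\left(\delta\sin\theta\cos\phi-\tfrac{\epsilon}{2}\cos^2\theta\right),$$ where $$\mathcal N=\int_0^{2\pi}\!\int_0^{\pi}\exp\!\left(\delta\sin\theta\cos\phi-\tfrac{\epsilon}{2}\cos^2\theta\right)\sin\theta\,d\theta\,d\phi .$$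
   Context: Consider bosons with two modes, with annihilation operators $\hat a_1,\hat a_2$ and creation operators $\hat a_1^\dagger,\hat a_2^\dagger$ satisfying $[\hat a_i,\hat a_j^\dagger]=\delta_{ij}$ (Kronecker delta) and $[\hat a_i,\hat a_j]=0$, acting on the two-mode boson Fock space with vacuum vector $|\emptyset\rangle$. The $N$-boson space is the $(N+1)$-dimensional eigenspace of $\hat a_1^\dagger\hat a_1+\hat a_2^\dagger\hat a_2$ with eigenvalue $N$. The two-site Bose-Hubbard Hamiltonian on the $N$-boson space is $$H_N=-J(\hat a_1^\dagger\hat a_2+\hat a_2^\dagger\hat a_1)+\frac{U}{2}\left(\hat a_1^\dagger\hat a_1^\dagger\hat a_1\hat a_1+\hat a_2^\dagger\hat a_2^\dagger\hat a_2\hat a_2\right),$$ restricted to that space. The constant $k_B>0$ is Boltzmann's constant. For $\theta\in[0,\pi]$, $\phi\in[0,2\pi)$ (spherical coordinates of a point on the unit sphere), the coherent state is the unit vector $$|\Psi^N_{\theta,\phi}\rangle=\frac{1}{\sqrt{N!}}\left(\cos\tfrac{\theta}{2}\,\hat a_1^\dagger+e^{i\phi}\sin\tfrac{\theta}{2}\,\hat a_2^\dagger\right)^N|\emptyset\rangle .$$ The canonical equilibrium ensemble at temperature $T$ is the density matrix $\hat\rho_{N,T}=e^{-H_N/k_BT}/\mathrm{Tr}\,(e^{-H_N/k_BT})$ on the $N$-boson space. Its Husimi distribution is $P_{N,T}(\theta,\phi)=\langle\Psi^N_{\theta,\phi}|\hat\rho_{N,T}|\Psi^N_{\theta,\phi}\rangle$,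 and its normalized Husimi distribution is $\tilde P_{N,T}=\frac{N+1}{4\pi}P_{N,T}$, which integrates to $1$ against the surface area measure $\sin\theta\,d\theta\,d\phi$ on the unit sphere. *)

theory Defs
  imports "HOL-Analysis.Analysis"
begin

text \<open>
  Vectors of the two-mode Fock space are given by their coefficients in the occupation-number
  basis: \<open>\<psi> (m, n)\<close> is the amplitude of having \<open>m\<close> bosons in mode 1 and \<open>n\<close> in mode 2.
  The ladder operators are defined by their coordinate formulas on arbitrary amplitude
  functions, so no domains of unbounded operators have to be tracked; on the
  finite-dimensional \<open>N\<close>-boson spaces this makes no difference.
\<close>

type_synonym amplitudes = "nat \<times> nat \<Rightarrow> complex"

definition fock_space :: "amplitudes set" where
  "fock_space = {\<psi>. (\<lambda>p. (cmod (\<psi> p))\<^sup>2) summable_on UNIV}"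

definition fock_inner :: "amplitudes \<Rightarrow> amplitudes \<Rightarrow> complex" where
  "fock_inner \<phi> \<psi> = (\<Sum>\<^sub>\<infinity>p. cnj (\<phi> p) * \<psi> p)"

definition occ :: "nat \<Rightarrow> nat \<Rightarrow> amplitudes" where
  "occ m n = (\<lambda>p. if p = (m, n) then 1 else 0)"

definition vacuum :: amplitudes where
  "vacuum = occ 0 0"

definition ann1 :: "amplitudes \<Rightarrow> amplitudes" where
  "ann1 \<psi> = (\<lambda>(m, n). complex_of_real (sqrt (real (m + 1))) * \<psi> (m + 1, n))"

definition ann2 :: "amplitudes \<Rightarrow> amplitudes" where
  "ann2 \<psi> = (\<lambda>(m, n). complex_of_real (sqrt (real (n + 1))) * \<psi> (m, n + 1))"

text \<open>In the creation operators the factor \<open>sqrt 0 = 0\<close> removes the truncated case \<open>0 - 1\<close>.\<close>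

definition cre1 :: "amplitudes \<Rightarrow> amplitudes" where
  "cre1 \<psi> = (\<lambda>(m, n). complex_of_real (sqrt (real m)) * \<psi> (m - 1, n))"

definition cre2 :: "amplitudes \<Rightarrow> amplitudes" where
  "cre2 \<psi> = (\<lambda>(m, n). complex_of_real (sqrt (real n)) * \<psi> (m, n - 1))"

lemma sqrt_mult_self_complex:
  "complex_of_real (sqrt (real k)) * (complex_of_real (sqrt (real k)) * z) = of_nat k * z"
proof -
  have "complex_of_real (sqrt (real k)) * complex_of_real (sqrt (real k)) = of_nat k"
    by (simp flip: of_real_mult)
  then show ?thesis by (simp flip: mult.assoc)
qed

lemma cre1_ann1: "cre1 (ann1 \<psi>) = (\<lambda>(m, n). of_nat m * \<psi> (m, n))"
proof
  fix p show "cre1 (ann1 \<psi>) p = (\<lambda>(m, n). of_nat m * \<psi> (m, n)) p"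
    by (cases p; cases "fst p")
      (simp_all add: cre1_def ann1_def sqrt_mult_self_complex[of "Suc _", simplified])
qed

lemma cre2_ann2: "cre2 (ann2 \<psi>) = (\<lambda>(m, n). of_nat n * \<psi> (m, n))"
proof
  fix p show "cre2 (ann2 \<psi>) p = (\<lambda>(m, n). of_nat n * \<psi> (m, n)) p"
    by (cases p; cases "snd p")
      (simp_all add: cre2_def ann2_def sqrt_mult_self_complex[of "Suc _", simplified])
qed

lemma canonical_commutation_relations:
  "ann1 (cre1 \<psi>) p - cre1 (ann1 \<psi>) p = \<psi> p"
  "ann2 (cre2 \<psi>) p - cre2 (ann2 \<psi>) p = \<psi> p"
  "ann1 (cre2 \<psi>) p - cre2 (ann1 \<psi>) p = 0"
  "ann2 (cre1 \<psi>) p - cre1 (ann2 \<psi>) p = 0"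
  "ann1 (ann2 \<psi>) p - ann2 (ann1 \<psi>) p = 0"
proof -
  have sq: "complex_of_real (sqrt (1 + real k)) * complex_of_real (sqrt (1 + real k))
      = 1 + of_nat k" for k
    by (simp flip: of_real_mult)
  show "ann1 (cre1 \<psi>) p - cre1 (ann1 \<psi>) p = \<psi> p"
    unfolding cre1_ann1
    by (cases p) (simp add: cre1_def ann1_def sq mult.assoc[symmetric] distrib_right)
  show "ann2 (cre2 \<psi>) p - cre2 (ann2 \<psi>) p = \<psi> p"
    unfolding cre2_ann2
    by (cases p) (simp add: cre2_def ann2_def sq mult.assoc[symmetric] distrib_right)
qed (cases p; simp add: ann1_def ann2_def cre1_def cre2_def)+

definition boson_space :: "nat \<Rightarrow> amplitudes set" where
  "boson_space N =
     {\<psi> \<in> fock_space. (\<lambda>p. cre1 (ann1 \<psi>) p + cre2 (ann2 \<psi>) p) = (\<lambda>p. of_nat N * \<psi> p)}"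

lemma boson_space_iff:
  "\<psi> \<in> boson_space N \<longleftrightarrow> (\<forall>m n. m + n \<noteq> N \<longrightarrow> \<psi> (m, n) = 0)"
proof
  assume \<psi>: "\<psi> \<in> boson_space N"
  show "\<forall>m n. m + n \<noteq> N \<longrightarrow> \<psi> (m, n) = 0"
  proof (intro allI impI)
    fix m n :: nat assume ne: "m + n \<noteq> N"
    have "(\<lambda>p. cre1 (ann1 \<psi>) p + cre2 (ann2 \<psi>) p) (m, n) = of_nat N * \<psi> (m, n)"
      using \<psi> by (auto simp: boson_space_def dest: fun_cong)
    then have "(of_nat (m + n) - of_nat N) * \<psi> (m, n) = 0"
      by (simp add: cre1_ann1 cre2_ann2 algebra_simps)
    moreover have "(of_nat (m + n) :: complex) \<noteq> of_nat N"
      using ne by (simp only: of_nat_eq_iff not_False_eq_True)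
    ultimately show "\<psi> (m, n) = 0" by simp
  qed
next
  assume \<psi>: "\<forall>m n. m + n \<noteq> N \<longrightarrow> \<psi> (m, n) = 0"
  have "(\<lambda>p. (cmod (\<psi> p))\<^sup>2) summable_on {..N} \<times> {..N}"
    by (intro summable_on_finite) simp
  moreover have "\<psi> p = 0" if "p \<notin> {..N} \<times> {..N}" for p
    using that \<psi> by (cases p) auto
  ultimately have "\<psi> \<in> fock_space"
    unfolding fock_space_def mem_Collect_eq
    by (subst summable_on_cong_neutral[where T = "{..N} \<times> {..N}"]) auto
  moreover have "cre1 (ann1 \<psi>) p + cre2 (ann2 \<psi>) p = of_nat N * \<psi> p" for p
    using \<psi> by (cases p; cases "fst p + snd p = N")
      (auto simp: cre1_ann1 cre2_ann2 algebra_simps)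
  ultimately show "\<psi> \<in> boson_space N" by (auto simp: boson_space_def)
qed

definition bose_hubbard :: "real \<Rightarrow> real \<Rightarrow> amplitudes \<Rightarrow> amplitudes" where
  "bose_hubbard J U \<psi> = (\<lambda>p.
     - complex_of_real J * (cre1 (ann2 \<psi>) p + cre2 (ann1 \<psi>) p)
     + complex_of_real (U / 2) *
         (cre1 (cre1 (ann1 (ann1 \<psi>))) p + cre2 (cre2 (ann2 (ann2 \<psi>))) p))"

lemma bose_hubbard_boson_space:
  "\<psi> \<in> boson_space N \<Longrightarrow> bose_hubbard J U \<psi> \<in> boson_space N"
  unfolding boson_space_iff
proof (intro allI impI)
  fix m n :: nat
  assume \<psi>: "\<forall>m n. m + n \<noteq> N \<longrightarrow> \<psi> (m, n) = 0" and ne: "m + n \<noteq> N"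
  have "cre1 (ann2 \<psi>) (m, n) = 0" "cre1 (cre1 (ann1 (ann1 \<psi>))) (m, n) = 0"
    using \<psi> ne by (cases m; cases "m - 1"; simp add: cre1_def ann1_def ann2_def)+
  moreover have "cre2 (ann1 \<psi>) (m, n) = 0" "cre2 (cre2 (ann2 (ann2 \<psi>))) (m, n) = 0"
    using \<psi> ne by (cases n; cases "n - 1"; simp add: cre2_def ann1_def ann2_def)+
  ultimately show "bose_hubbard J U \<psi> (m, n) = 0"
    by (simp add: bose_hubbard_def)
qed

definition bose_hubbard_on :: "nat \<Rightarrow> real \<Rightarrow> real \<Rightarrow> amplitudes \<Rightarrow> amplitudes" where
  "bose_hubbard_on N J U = restrict (bose_hubbard J U) (boson_space N)"

text \<open>
  The exponential series \<open>\<Sum>k. A\<^sup>k / k!\<close> is summed coordinatewise. It is only applied to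
  operators on a finite-dimensional space, where this is the usual operator exponential.
\<close>

definition op_exp :: "(amplitudes \<Rightarrow> amplitudes) \<Rightarrow> amplitudes \<Rightarrow> amplitudes" where
  "op_exp A \<psi> = (\<lambda>p. \<Sum>k. (A ^^ k) \<psi> p / fact k)"

text \<open>The vectors \<open>occ n (N - n)\<close>, \<open>n \<le> N\<close>, form an orthonormal basis of \<open>boson_space N\<close>.\<close>

definition trace_on :: "nat \<Rightarrow> (amplitudes \<Rightarrow> amplitudes) \<Rightarrow> complex" where
  "trace_on N A = (\<Sum>n\<le>N. fock_inner (occ n (N - n)) (A (occ n (N - n))))"

definition boltzmann_op :: "real \<Rightarrow> nat \<Rightarrow> real \<Rightarrow> real \<Rightarrow> real \<Rightarrow> amplitudes \<Rightarrow> amplitudes" where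
  "boltzmann_op kB N J U T =
     op_exp (\<lambda>\<psi> p. - bose_hubbard_on N J U \<psi> p / complex_of_real (kB * T))"

definition canonical_ensemble ::
    "real \<Rightarrow> nat \<Rightarrow> real \<Rightarrow> real \<Rightarrow> real \<Rightarrow> amplitudes \<Rightarrow> amplitudes" where
  "canonical_ensemble kB N J U T \<psi> =
     (\<lambda>p. boltzmann_op kB N J U T \<psi> p / trace_on N (boltzmann_op kB N J U T))"

definition coherent_state :: "nat \<Rightarrow> real \<Rightarrow> real \<Rightarrow> amplitudes" where
  "coherent_state N \<theta> \<phi> = (\<lambda>p.
     ((\<lambda>\<psi> q. complex_of_real (cos (\<theta> / 2)) * cre1 \<psi> q
              + exp (\<i> * complex_of_real \<phi>) * complex_of_real (sin (\<theta> / 2)) * cre2 \<psi> q) ^^ N)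
       vacuum p / complex_of_real (sqrt (fact N)))"

text \<open>
  The Husimi distribution is kept complex-valued, as the inner product is; that its values
  are real is a consequence of the Hamiltonian being self-adjoint.
\<close>

definition husimi :: "real \<Rightarrow> nat \<Rightarrow> real \<Rightarrow> real \<Rightarrow> real \<Rightarrow> real \<Rightarrow> real \<Rightarrow> complex" where
  "husimi kB N J U T \<theta> \<phi> =
     fock_inner (coherent_state N \<theta> \<phi>) (canonical_ensemble kB N J U T (coherent_state N \<theta> \<phi>))"

definition normalized_husimi ::
    "real \<Rightarrow> nat \<Rightarrow> real \<Rightarrow> real \<Rightarrow> real \<Rightarrow> real \<Rightarrow> real \<Rightarrow> complex" where
  "normalized_husimi kB N J U T \<theta> \<phi> =
     complex_of_real (real (N + 1) / (4 * pi)) * husimi kB N J U T \<theta> \<phi>"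

end

theory Submission imports Defs begin

text \<open>
  Put \<open>A = - H / (kB * T)\<close> on the \<open>N\<close>-boson space. In the given scaling the norm of \<open>A\<close> is bounded
  uniformly in \<open>N\<close>, and the variances of Bernstein polynomials show that a coherent state \<open>\<Psi>\<close> is an
  approximate eigenvector: \<open>\<parallel>A \<Psi> - h \<Psi>\<parallel> = O(1 / sqrt N)\<close> uniformly on the sphere, where \<open>h\<close> is the
  classical symbol of \<open>A\<close>. By the exponential series, \<open>\<langle>\<Psi>|exp A|\<Psi>\<rangle>\<close> tends to \<open>exp h\<close> uniformly. The
  resolution of the identity by coherent states expresses \<open>4 * pi / (N + 1) * Tr (exp A)\<close> as the
  integral of \<open>\<langle>\<Psi>|exp A|\<Psi>\<rangle>\<close> over the sphere, so it tends to the integral of \<open>exp h\<close>.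
\<close>

subsection \<open>Bounded operators on the boson spaces\<close>

text \<open>The scaling keeps the exponent of order one: each hopping term has norm at most N and is
  weighted by \<open>\<delta> / N\<close>, while the pair count is at most N^2 and is weighted by
  \<open>\<epsilon> / N^2\<close>. One constant therefore serves all N in the exponential series. In
  a coherent state with mode amplitudes \<open>\<alpha>\<close> and \<open>\<beta>\<close>, the
  occupation m of mode 1 is binomial with success probability p = |\<open>\<alpha>\<close>|^2. Each
  term of A acts on the coefficients through m / N, up to a correction 1 / N, so replacing m / N by
  its mean p costs one standard deviation, of order 1 / sqrt N. The hopping terms do this only
  formally, through a quotient such as \<open>\<beta> / \<alpha>\<close>, so their estimate is
  stated in a multiplied-out form that survives \<open>\<alpha> = 0\<close>. The trace has no closed
  form. Averaging over coherent states reduces it to the expectations already estimated for the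
  numerator, and uniformity in the angles is what allows that estimate to be integrated. Numerator
  and denominator then converge separately, and positivity of the limiting integral permits the
  quotient.\<close>

definition bnorm :: "nat \<Rightarrow> amplitudes \<Rightarrow> real" where
  "bnorm N \<psi> = L2_set (\<lambda>m. cmod (\<psi> (m, N - m))) {..N}"

lemma bnorm_nonneg [simp]: "0 \<le> bnorm N \<psi>"
  by (simp add: bnorm_def)

text \<open>Only the coordinates of the N-boson sector enter \<open>bnorm\<close>: it is a seminorm
  on all amplitude functions and a norm on \<open>boson_space N\<close>.\<close>

lemma bnorm_add: "bnorm N (\<lambda>p. \<psi> p + \<eta> p) \<le> bnorm N \<psi> + bnorm N \<eta>"
  unfolding bnorm_def
  by (rule order_trans[OF L2_set_mono L2_set_triangle_ineq]) (auto intro: norm_triangle_ineq)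

lemma bnorm_scale: "bnorm N (\<lambda>p. c * \<psi> p) = cmod c * bnorm N \<psi>"
  by (simp add: bnorm_def norm_mult L2_set_right_distrib)

lemma cmod_le_bnorm:
  assumes "\<psi> \<in> boson_space N" shows "cmod (\<psi> p) \<le> bnorm N \<psi>"
proof (cases p)
  case (Pair m n)
  show ?thesis
  proof (cases "m + n = N")
    case True
    then have "n = N - m" "m \<in> {..N}" by auto
    then show ?thesis unfolding bnorm_def Pair
      using member_le_L2_set[of "{..N}" m "\<lambda>m. cmod (\<psi> (m, N - m))"] by simp
  next
    case False
    then show ?thesis using assms by (simp add: boson_space_iff Pair)
  qed
qed

lemma fock_inner_boson_space:
  assumes "\<phi> \<in> boson_space N"
  shows "fock_inner \<phi> \<psi> = (\<Sum>m\<le>N. cnj (\<phi> (m, N - m)) * \<psi> (m, N - m))"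
proof -
  let ?D = "(\<lambda>m. (m, N - m)) ` {..N}"
  have "\<phi> p = 0" if "p \<notin> ?D" for p
    using that assms by (cases p) (force simp: boson_space_iff)
  then have "fock_inner \<phi> \<psi> = (\<Sum>\<^sub>\<infinity>p\<in>?D. cnj (\<phi> p) * \<psi> p)"
    unfolding fock_inner_def by (intro infsum_cong_neutral) auto
  also have "\<dots> = (\<Sum>p\<in>?D. cnj (\<phi> p) * \<psi> p)" by simp
  also have "\<dots> = (\<Sum>m\<le>N. cnj (\<phi> (m, N - m)) * \<psi> (m, N - m))"
    by (subst sum.reindex) (auto simp: inj_on_def)
  finally show ?thesis .
qed

lemma fock_inner_self:
  assumes "\<psi> \<in> boson_space N"
  shows "fock_inner \<psi> \<psi> = complex_of_real ((bnorm N \<psi>)\<^sup>2)"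
proof -
  have "cnj z * z = complex_of_real ((cmod z)\<^sup>2)" for z
    by (metis complex_norm_square mult.commute)
  then show ?thesis
    by (simp add: fock_inner_boson_space[OF assms] bnorm_def L2_set_def sum_nonneg)
qed

lemma fock_inner_cauchy_schwarz:
  assumes "\<phi> \<in> boson_space N"
  shows "cmod (fock_inner \<phi> \<psi>) \<le> bnorm N \<phi> * bnorm N \<psi>"
proof -
  have "cmod (fock_inner \<phi> \<psi>)
      \<le> (\<Sum>m\<le>N. \<bar>cmod (\<phi> (m, N - m))\<bar> * \<bar>cmod (\<psi> (m, N - m))\<bar>)"
    unfolding fock_inner_boson_space[OF assms] by (rule sum_norm_le) (simp add: norm_mult)
  also have "\<dots> \<le> bnorm N \<phi> * bnorm N \<psi>"
    unfolding bnorm_def by (rule L2_set_mult_ineq)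
  finally show ?thesis .
qed

lemma boson_space_lincomb:
  "\<psi> \<in> boson_space N \<Longrightarrow> \<eta> \<in> boson_space N \<Longrightarrow> (\<lambda>p. a * \<psi> p + b * \<eta> p) \<in> boson_space N"
  by (auto simp: boson_space_iff)

lemma occ_boson_space [simp]: "m \<le> N \<Longrightarrow> occ m (N - m) \<in> boson_space N"
  by (auto simp: boson_space_iff occ_def)

lemma fock_inner_occ: "m \<le> N \<Longrightarrow> fock_inner (occ m (N - m)) \<psi> = \<psi> (m, N - m)"
proof (subst fock_inner_boson_space[of _ N])
  assume m: "m \<le> N"
  then show "occ m (N - m) \<in> boson_space N" by simp
  have "(\<Sum>k\<le>N. cnj (occ m (N - m) (k, N - k)) * \<psi> (k, N - k))
      = (\<Sum>k\<le>N. if k = m then \<psi> (k, N - k) else 0)"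
    using m by (intro sum.cong) (auto simp: occ_def)
  then show "(\<Sum>k\<le>N. cnj (occ m (N - m) (k, N - k)) * \<psi> (k, N - k)) = \<psi> (m, N - m)"
    using m by simp
qed

text \<open>The requirement \<open>1 \<le> C\<close> lets powers of \<open>2 * C\<close> absorb
  lower-order terms in the error recursion for powers of \<open>A\<close>.\<close>

locale bounded_boson_op =
  fixes N :: nat and A :: "amplitudes \<Rightarrow> amplitudes" and C :: real
  assumes closed: "\<psi> \<in> boson_space N \<Longrightarrow> A \<psi> \<in> boson_space N"
    and lincomb: "\<psi> \<in> boson_space N \<Longrightarrow> \<eta> \<in> boson_space N \<Longrightarrow>
      A (\<lambda>p. a * \<psi> p + b * \<eta> p) = (\<lambda>p. a * A \<psi> p + b * A \<eta> p)"
    and bound: "\<psi> \<in> boson_space N \<Longrightarrow> bnorm N (A \<psi>) \<le> C * bnorm N \<psi>"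
    and C_ge_1: "1 \<le> C"
begin

section \<open>Powers and exponential of a bounded operator\<close>

lemma pow_closed: "\<psi> \<in> boson_space N \<Longrightarrow> (A ^^ k) \<psi> \<in> boson_space N"
  by (induction k) (auto intro: closed)

lemma pow_lincomb:
  assumes "\<psi> \<in> boson_space N" "\<eta> \<in> boson_space N"
  shows "(A ^^ k) (\<lambda>p. a * \<psi> p + b * \<eta> p) = (\<lambda>p. a * (A ^^ k) \<psi> p + b * (A ^^ k) \<eta> p)"
  by (induction k) (simp_all add: lincomb pow_closed assms)

lemma pow_bound:
  assumes "\<psi> \<in> boson_space N"
  shows "bnorm N ((A ^^ k) \<psi>) \<le> C ^ k * bnorm N \<psi>"
proof (induction k)
  case (Suc k)
  have "bnorm N ((A ^^ Suc k) \<psi>) \<le> C * bnorm N ((A ^^ k) \<psi>)"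
    using bound[OF pow_closed[OF assms]] by simp
  also have "\<dots> \<le> C * (C ^ k * bnorm N \<psi>)"
    using Suc C_ge_1 by (intro mult_left_mono) auto
  finally show ?case by simp
qed simp

text \<open>\<open>op_exp\<close> is a coordinatewise \<open>suminf\<close>, informative only where
  the series converges. A coordinate is bounded by the norm, so the exponential series of
  \<open>C\<close> dominates.\<close>

lemma op_exp_sums:
  assumes "\<psi> \<in> boson_space N"
  shows "(\<lambda>k. (A ^^ k) \<psi> p / fact k) sums op_exp A \<psi> p"
proof -
  have "summable (\<lambda>k. C ^ k / fact k * bnorm N \<psi>)"
    using summable_exp[of C] by (intro summable_mult2) (simp add: field_simps)
  then have "summable (\<lambda>k. (A ^^ k) \<psi> p / fact k)"
  proof (rule summable_comparison_test[rotated], intro exI allI impI)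
    fix k
    have "cmod ((A ^^ k) \<psi> p) \<le> C ^ k * bnorm N \<psi>"
      using cmod_le_bnorm[OF pow_closed[OF assms]] pow_bound[OF assms] order_trans by blast
    then show "norm ((A ^^ k) \<psi> p / fact k) \<le> C ^ k / fact k * bnorm N \<psi>"
      by (simp add: norm_divide divide_right_mono)
  qed
  then show ?thesis unfolding op_exp_def by (rule summable_sums)
qed

lemma op_exp_lincomb:
  assumes "\<psi> \<in> boson_space N" "\<eta> \<in> boson_space N"
  shows "op_exp A (\<lambda>p. a * \<psi> p + b * \<eta> p) p = a * op_exp A \<psi> p + b * op_exp A \<eta> p"
proof -
  have "(\<lambda>k. (A ^^ k) (\<lambda>p. a * \<psi> p + b * \<eta> p) p / fact k) sums
      (a * op_exp A \<psi> p + b * op_exp A \<eta> p)"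
    using sums_add[OF sums_mult[OF op_exp_sums[OF assms(1)], of a p]
        sums_mult[OF op_exp_sums[OF assms(2)], of b p]]
    by (simp add: pow_lincomb[OF assms] add_divide_distrib)
  then show ?thesis
    using op_exp_sums[OF boson_space_lincomb[OF assms]] sums_unique2 by blast
qed

text \<open>Membership is proved together with the formula because the induction step applies
  \<open>op_exp_lincomb\<close> to the partial sum.\<close>

lemma op_exp_sum:
  assumes "finite I" "\<And>i. i \<in> I \<Longrightarrow> f i \<in> boson_space N"
  shows "(\<lambda>p. \<Sum>i\<in>I. c i * f i p) \<in> boson_space N \<and>
    op_exp A (\<lambda>p. \<Sum>i\<in>I. c i * f i p) p = (\<Sum>i\<in>I. c i * op_exp A (f i) p)"
  using assms
proof (induction I rule: finite_induct)
  case empty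
  have 0: "(\<lambda>p. 0) \<in> boson_space N" by (simp add: boson_space_iff)
  show ?case using op_exp_lincomb[OF 0 0, of 0 0] 0 by simp
next
  case (insert i I)
  then have IH: "(\<lambda>p. \<Sum>i\<in>I. c i * f i p) \<in> boson_space N"
    "op_exp A (\<lambda>p. \<Sum>i\<in>I. c i * f i p) p = (\<Sum>i\<in>I. c i * op_exp A (f i) p)"
    and fi: "f i \<in> boson_space N" by auto
  show ?case
    using op_exp_lincomb[OF fi IH(1), of "c i" 1 p] boson_space_lincomb[OF fi IH(1), of "c i" 1]
      insert(1,2) IH(2)
    by simp
qed

text \<open>Expansion in the occupation basis separates the coordinates of the vector, which will
  depend on the angles, from the fixed matrix of \<open>op_exp A\<close>.\<close>

lemma op_exp_matrix:
  assumes "\<psi> \<in> boson_space N"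
  shows "op_exp A \<psi> p = (\<Sum>m\<le>N. \<psi> (m, N - m) * op_exp A (occ m (N - m)) p)"
proof -
  have "\<psi> = (\<lambda>p. \<Sum>m\<le>N. \<psi> (m, N - m) * occ m (N - m) p)"
  proof
    fix p :: "nat \<times> nat"
    obtain a b where p: "p = (a, b)" by (cases p)
    show "\<psi> p = (\<Sum>m\<le>N. \<psi> (m, N - m) * occ m (N - m) p)"
    proof (cases "a + b = N")
      case True
      then have "(\<Sum>m\<le>N. \<psi> (m, N - m) * occ m (N - m) p)
          = (\<Sum>m\<le>N. if m = a then \<psi> (m, N - m) else 0)"
        by (intro sum.cong) (auto simp: occ_def p)
      then show ?thesis using True p by auto
    next
      case False
      then show ?thesis using assms by (auto simp: boson_space_iff p occ_def intro!: sum.neutral)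
    qed
  qed
  then have "op_exp A \<psi> p = op_exp A (\<lambda>p. \<Sum>m\<le>N. \<psi> (m, N - m) * occ m (N - m) p) p"
    by (rule arg_cong)
  also have "\<dots> = (\<Sum>m\<le>N. \<psi> (m, N - m) * op_exp A (occ m (N - m)) p)"
    by (rule op_exp_sum[THEN conjunct2]) auto
  finally show ?thesis .
qed

text \<open>With d = A psi - h psi, the induction rests on A^(k+1) psi - h^(k+1) psi = A^k d + h
  (A^k psi - h^k psi). Unrolling would give the factor k C^(k-1); the cruder
  \<open>(2 * C) ^ k\<close> is easier to propagate and still summable against
  \<open>fact k\<close>.\<close>

lemma pow_near_eigenvalue:
  assumes \<psi>: "\<psi> \<in> boson_space N" and h: "cmod h \<le> C"
  shows "bnorm N (\<lambda>p. (A ^^ k) \<psi> p - h ^ k * \<psi> p)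
    \<le> (2 * C) ^ k * bnorm N (\<lambda>p. A \<psi> p - h * \<psi> p)"
proof (induction k)
  case 0
  show ?case by (simp add: bnorm_def L2_set_def sum_nonneg)
next
  case (Suc k)
  define d where "d = (\<lambda>p. A \<psi> p - h * \<psi> p)"
  have d: "d \<in> boson_space N"
    using boson_space_lincomb[OF closed[OF \<psi>] \<psi>, of 1 "- h"] by (simp add: d_def)
  have "(A ^^ k) d = (\<lambda>p. (A ^^ Suc k) \<psi> p - h * (A ^^ k) \<psi> p)"
    using pow_lincomb[OF closed[OF \<psi>] \<psi>, of k 1 "- h"]
    by (simp add: d_def funpow_swap1)
  then have "(\<lambda>p. (A ^^ Suc k) \<psi> p - h ^ Suc k * \<psi> p)
      = (\<lambda>p. (A ^^ k) d p + h * ((A ^^ k) \<psi> p - h ^ k * \<psi> p))"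
    by (auto simp: algebra_simps)
  then have "bnorm N (\<lambda>p. (A ^^ Suc k) \<psi> p - h ^ Suc k * \<psi> p)
      \<le> bnorm N ((A ^^ k) d) + cmod h * bnorm N (\<lambda>p. (A ^^ k) \<psi> p - h ^ k * \<psi> p)"
    using bnorm_add[of N "(A ^^ k) d" "\<lambda>p. h * ((A ^^ k) \<psi> p - h ^ k * \<psi> p)"]
    by (simp add: bnorm_scale)
  also have "\<dots> \<le> C ^ k * bnorm N d + C * ((2 * C) ^ k * bnorm N d)"
    using pow_bound[OF d] h Suc C_ge_1 by (intro add_mono mult_mono) (auto simp: d_def)
  also have "\<dots> \<le> (2 * C) ^ Suc k * bnorm N d"
  proof -
    have "C ^ k \<le> (2 * C) ^ k" "(2 * C) ^ k \<le> C * (2 * C) ^ k"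
      using C_ge_1 mult_right_mono[of 1 C "(2 * C) ^ k"] by (auto intro: power_mono)
    then have "C ^ k + C * (2 * C) ^ k \<le> (2 * C) ^ Suc k" unfolding power_Suc by linarith
    then have "(C ^ k + C * (2 * C) ^ k) * bnorm N d \<le> (2 * C) ^ Suc k * bnorm N d"
      by (intro mult_right_mono) auto
    then show ?thesis by (simp add: algebra_simps)
  qed
  finally show ?case by (simp add: d_def)
qed

text \<open>Unit norm makes \<open>h ^ k\<close> the inner product of the vector with its
  \<open>h ^ k\<close> multiple, so Cauchy-Schwarz reduces each term to the previous estimate. The
  bounds sum to the series of \<open>exp (2 * C)\<close>.\<close>

lemma op_exp_near_eigenvalue:
  assumes \<psi>: "\<psi> \<in> boson_space N" and h: "cmod h \<le> C" and unit: "bnorm N \<psi> = 1"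
  shows "cmod (fock_inner \<psi> (op_exp A \<psi>) - exp h)
    \<le> exp (2 * C) * bnorm N (\<lambda>p. A \<psi> p - h * \<psi> p)"
proof -
  define D where "D = bnorm N (\<lambda>p. A \<psi> p - h * \<psi> p)"
  define s where "s k = (fock_inner \<psi> ((A ^^ k) \<psi>) - h ^ k) / fact k" for k
  have inner_sub: "fock_inner \<psi> ((A ^^ k) \<psi>) - h ^ k
      = fock_inner \<psi> (\<lambda>p. (A ^^ k) \<psi> p - h ^ k * \<psi> p)" for k
    using fock_inner_self[OF \<psi>] unit
    by (simp add: fock_inner_boson_space[OF \<psi>] algebra_simps sum_subtractf flip: sum_distrib_left)
  have "(\<lambda>k. \<Sum>m\<le>N. cnj (\<psi> (m, N - m)) * ((A ^^ k) \<psi> (m, N - m) / fact k)) sums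
      fock_inner \<psi> (op_exp A \<psi>)"
    unfolding fock_inner_boson_space[OF \<psi>]
    by (intro sums_sum sums_mult op_exp_sums \<psi>)
  then have "(\<lambda>k. fock_inner \<psi> ((A ^^ k) \<psi>) / fact k) sums fock_inner \<psi> (op_exp A \<psi>)"
    by (simp add: fock_inner_boson_space[OF \<psi>] sum_divide_distrib)
  moreover have "(\<lambda>k. h ^ k / fact k) sums exp h"
    using exp_converges[of h] by (simp add: scaleR_conv_of_real field_simps)
  ultimately have s: "s sums (fock_inner \<psi> (op_exp A \<psi>) - exp h)"
    unfolding s_def diff_divide_distrib by (rule sums_diff)
  have "(\<lambda>k. (2 * C) ^ k / fact k * D) sums (exp (2 * C) * D)"
    using exp_converges[of "2 * C"] by (intro sums_mult2) (simp add: field_simps)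
  moreover have "norm (s k) \<le> (2 * C) ^ k / fact k * D" for k
  proof -
    have "cmod (fock_inner \<psi> ((A ^^ k) \<psi>) - h ^ k) \<le> (2 * C) ^ k * D"
      using fock_inner_cauchy_schwarz[OF \<psi>, of "\<lambda>p. (A ^^ k) \<psi> p - h ^ k * \<psi> p"]
        pow_near_eigenvalue[OF \<psi> h, of k]
      by (simp add: inner_sub unit D_def)
    then show ?thesis by (simp add: s_def norm_divide divide_right_mono)
  qed
  ultimately have "norm (suminf s) \<le> suminf (\<lambda>k. (2 * C) ^ k / fact k * D)"
    by (intro norm_suminf_le) (auto intro: sums_summable)
  then show ?thesis
    using s \<open>(\<lambda>k. (2 * C) ^ k / fact k * D) sums (exp (2 * C) * D)\<close>
    by (simp add: sums_iff D_def)
qed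

end

subsection \<open>The scaled Hamiltonian and the coherent states\<close>

text \<open>Exchange symmetry of the modes: estimates for hopping from mode 1 to mode 2 follow from
  those in the opposite direction.\<close>

definition swap_modes :: "amplitudes \<Rightarrow> amplitudes" where
  "swap_modes \<psi> = (\<lambda>(m, n). \<psi> (n, m))"

lemma cre2_ann1_swap: "cre2 (ann1 \<psi>) = swap_modes (cre1 (ann2 (swap_modes \<psi>)))"
  by (auto simp: swap_modes_def cre1_def cre2_def ann1_def ann2_def)

lemma bnorm_swap [simp]: "bnorm N (swap_modes \<psi>) = bnorm N \<psi>"
proof -
  have "(\<Sum>m\<le>N. (cmod (\<psi> (N - m, m)))\<^sup>2) = (\<Sum>m\<le>N. (cmod (\<psi> (m, N - m)))\<^sup>2)"
    by (rule sum.reindex_bij_witness[of _ "\<lambda>m. N - m" "\<lambda>m. N - m"]) auto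
  then show ?thesis by (simp add: bnorm_def L2_set_def swap_modes_def)
qed

lemma bnorm_hop12: "bnorm N (cre1 (ann2 \<psi>)) \<le> real N * bnorm N \<psi>"
proof -
  \<comment> \<open>The term m = 0 vanishes through \<open>sqrt 0\<close>; the others are reindexed
    by m = j + 1, and both j + 1 and N - j are at most N.\<close>
  have "(\<Sum>m\<le>N. (cmod (cre1 (ann2 \<psi>) (m, N - m)))\<^sup>2)
      = (\<Sum>j<N. real (Suc j) * real (N - j) * (cmod (\<psi> (j, N - j)))\<^sup>2)"
    unfolding sum.atMost_shift
    by (auto simp: cre1_def ann2_def norm_mult power_mult_distrib Suc_diff_Suc intro!: sum.cong)
  also have "\<dots> \<le> (\<Sum>j<N. (real N)\<^sup>2 * (cmod (\<psi> (j, N - j)))\<^sup>2)"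
    unfolding power2_eq_square[of "real N"]
    by (intro sum_mono mult_right_mono mult_mono) auto
  also have "\<dots> \<le> (\<Sum>j\<le>N. (real N)\<^sup>2 * (cmod (\<psi> (j, N - j)))\<^sup>2)"
    by (intro sum_mono2) auto
  also have "\<dots> = (real N * bnorm N \<psi>)\<^sup>2"
    by (simp add: bnorm_def L2_set_def power_mult_distrib sum_nonneg sum_distrib_left)
  finally show ?thesis
    unfolding bnorm_def[of N "cre1 _"] L2_set_def
    by (intro real_le_lsqrt) (auto simp: sum_nonneg)
qed

lemma bnorm_hop21: "bnorm N (cre2 (ann1 \<psi>)) \<le> real N * bnorm N \<psi>"
  using bnorm_hop12[of N "swap_modes \<psi>"] by (simp add: cre2_ann1_swap)

text \<open>This counts ordered pairs of distinct bosons in the same mode. Subtraction is taken in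
  the reals, so m = 0 gives 0 * (-1) = 0.\<close>

definition pair_count :: "nat \<times> nat \<Rightarrow> real" where
  "pair_count = (\<lambda>(m, n). real m * (real m - 1) + real n * (real n - 1))"

lemma interaction_diagonal:
  "cre1 (cre1 (ann1 (ann1 \<psi>))) p + cre2 (cre2 (ann2 (ann2 \<psi>))) p
    = complex_of_real (pair_count p) * \<psi> p"
proof -
  have ladder: "complex_of_real (sqrt (real (Suc (Suc k)))) * (complex_of_real (sqrt (real (Suc k))) *
      (complex_of_real (sqrt (real (Suc k))) * (complex_of_real (sqrt (real (Suc (Suc k)))) * z)))
      = of_nat (Suc (Suc k)) * of_nat (Suc k) * z" for k z
    using sqrt_mult_self_complex[of "Suc k"] sqrt_mult_self_complex[of "Suc (Suc k)"]
    by (metis mult.assoc mult.left_commute)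
  obtain m n where p: "p = (m, n)" by (cases p)
  have 1: "cre1 (cre1 (ann1 (ann1 \<psi>))) (m, n) = complex_of_real (real m * (real m - 1)) * \<psi> (m, n)"
  \<comment> \<open>For m at most 1 both sides vanish: one of the two creation operators contributes
    \<open>sqrt 0\<close>, and m (m - 1) = 0.\<close>
  proof (cases "m \<le> 1")
    case True
    then show ?thesis by (cases m) (auto simp: cre1_def)
  next
    case False
    then obtain k where m: "m = Suc (Suc k)" by (metis One_nat_def le_SucI le_zero_eq nat.exhaust order_refl)
    show ?thesis
      using ladder[of k "\<psi> (m, n)"] by (simp add: cre1_def ann1_def m del: of_nat_Suc) (simp add: mult_ac)
  qed
  have 2: "cre2 (cre2 (ann2 (ann2 \<psi>))) (m, n) = complex_of_real (real n * (real n - 1)) * \<psi> (m, n)"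
  proof (cases "n \<le> 1")
    case True
    then show ?thesis by (cases n) (auto simp: cre2_def)
  next
    case False
    then obtain k where n: "n = Suc (Suc k)" by (metis One_nat_def le_SucI le_zero_eq nat.exhaust order_refl)
    show ?thesis
      using ladder[of k "\<psi> (m, n)"] by (simp add: cre2_def ann2_def n del: of_nat_Suc) (simp add: mult_ac)
  qed
  show ?thesis by (simp add: p 1 2 pair_count_def distrib_right)
qed

lemma pair_count_bounds: "m \<le> N \<Longrightarrow> 0 \<le> pair_count (m, N - m) \<and> pair_count (m, N - m) \<le> (real N)\<^sup>2"
proof -
  assume m: "m \<le> N"
  have pos: "0 \<le> real k * (real k - 1)" for k by (cases k) auto
  have "(real N)\<^sup>2 = (real m + real (N - m))\<^sup>2" using m by (simp flip: of_nat_add)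
  then show ?thesis using pos[of m] pos[of "N - m"]
    by (simp add: pair_count_def power2_eq_square algebra_simps)
qed

text \<open>\<open>- H / (kB * T)\<close> on the \<open>N\<close>-boson space, with \<open>J\<close> and \<open>U\<close> eliminated in favour of \<open>\<delta>\<close> and \<open>\<epsilon>\<close>.\<close>

definition scaled_hamiltonian :: "nat \<Rightarrow> real \<Rightarrow> real \<Rightarrow> amplitudes \<Rightarrow> amplitudes" where
  "scaled_hamiltonian N \<delta> \<epsilon> \<psi> = (\<lambda>p.
     complex_of_real (\<delta> / real N) * (cre1 (ann2 \<psi>) p + cre2 (ann1 \<psi>) p)
     - complex_of_real (\<epsilon> / (real N)\<^sup>2 * pair_count p) * \<psi> p)"

lemma hop_boson_space:
  assumes "\<psi> \<in> boson_space N"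
  shows "cre1 (ann2 \<psi>) \<in> boson_space N" "cre2 (ann1 \<psi>) \<in> boson_space N"
proof -
  have "cre1 (ann2 \<psi>) (m, n) = 0" "cre2 (ann1 \<psi>) (m, n) = 0" if "m + n \<noteq> N" for m n
    using that assms
    by (cases m; cases n; auto simp: boson_space_iff cre1_def cre2_def ann1_def ann2_def)+
  then show "cre1 (ann2 \<psi>) \<in> boson_space N" "cre2 (ann1 \<psi>) \<in> boson_space N"
    by (auto simp: boson_space_iff)
qed

text \<open>Two hopping terms give 2 |\<open>\<delta>\<close>|, the diagonal term gives
  |\<open>\<epsilon>\<close>|, and the summand 1 secures \<open>1 \<le> C\<close>.\<close>

lemma bounded_scaled_hamiltonian:
  assumes N: "N \<ge> 1"
  shows "bounded_boson_op N (scaled_hamiltonian N \<delta> \<epsilon>) (1 + 2 * \<bar>\<delta>\<bar> + \<bar>\<epsilon>\<bar>)"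
proof
  fix \<psi> assume \<psi>: "\<psi> \<in> boson_space N"
  show "scaled_hamiltonian N \<delta> \<epsilon> \<psi> \<in> boson_space N"
    using \<psi> hop_boson_space[OF \<psi>] unfolding boson_space_iff
    by (auto simp: scaled_hamiltonian_def)
  define D where "D = (\<lambda>p. complex_of_real (- \<epsilon> / (real N)\<^sup>2 * pair_count p) * \<psi> p)"
  have D: "bnorm N D \<le> \<bar>\<epsilon>\<bar> * bnorm N \<psi>"
    unfolding bnorm_def L2_set_right_distrib[OF abs_ge_zero]
  proof (rule L2_set_mono)
    fix m assume "m \<in> {..N}"
    then have "\<bar>\<epsilon>\<bar> / (real N)\<^sup>2 * \<bar>pair_count (m, N - m)\<bar> \<le> \<bar>\<epsilon>\<bar> / (real N)\<^sup>2 * (real N)\<^sup>2"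
      using pair_count_bounds[of m N] by (intro mult_left_mono) auto
    also have "\<dots> = \<bar>\<epsilon>\<bar>" using N by simp
    finally show "cmod (D (m, N - m)) \<le> \<bar>\<epsilon>\<bar> * cmod (\<psi> (m, N - m))"
      unfolding D_def norm_mult norm_of_real
      by (intro mult_right_mono) (auto simp: abs_mult)
  qed simp
  have "scaled_hamiltonian N \<delta> \<epsilon> \<psi> = (\<lambda>p. complex_of_real (\<delta> / real N) *
      (\<lambda>q. cre1 (ann2 \<psi>) q + cre2 (ann1 \<psi>) q) p + D p)"
    by (auto simp: scaled_hamiltonian_def D_def)
  then have "bnorm N (scaled_hamiltonian N \<delta> \<epsilon> \<psi>)
      \<le> \<bar>\<delta>\<bar> / real N * bnorm N (\<lambda>q. cre1 (ann2 \<psi>) q + cre2 (ann1 \<psi>) q) + bnorm N D"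
    using bnorm_add[of N "\<lambda>p. complex_of_real (\<delta> / real N) * (\<lambda>q. cre1 (ann2 \<psi>) q + cre2 (ann1 \<psi>) q) p" D]
    by (simp only: bnorm_scale norm_of_real) simp
  also have "\<dots> \<le> \<bar>\<delta>\<bar> / real N * (real N * bnorm N \<psi> + real N * bnorm N \<psi>) + \<bar>\<epsilon>\<bar> * bnorm N \<psi>"
    by (intro add_mono mult_left_mono D order_trans[OF bnorm_add] bnorm_hop12 bnorm_hop21) auto
  also have "\<dots> = (2 * \<bar>\<delta>\<bar> + \<bar>\<epsilon>\<bar>) * bnorm N \<psi>"
    using N by (simp add: field_simps)
  also have "\<dots> \<le> (1 + 2 * \<bar>\<delta>\<bar> + \<bar>\<epsilon>\<bar>) * bnorm N \<psi>"
    by (intro mult_right_mono) auto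
  finally show "bnorm N (scaled_hamiltonian N \<delta> \<epsilon> \<psi>) \<le> (1 + 2 * \<bar>\<delta>\<bar> + \<bar>\<epsilon>\<bar>) * bnorm N \<psi>" .
next
  fix \<psi> \<eta> :: amplitudes and a b :: complex
  show "scaled_hamiltonian N \<delta> \<epsilon> (\<lambda>p. a * \<psi> p + b * \<eta> p)
      = (\<lambda>p. a * scaled_hamiltonian N \<delta> \<epsilon> \<psi> p + b * scaled_hamiltonian N \<delta> \<epsilon> \<eta> p)"
  proof
    fix p :: "nat \<times> nat"
    show "scaled_hamiltonian N \<delta> \<epsilon> (\<lambda>p. a * \<psi> p + b * \<eta> p) p
        = a * scaled_hamiltonian N \<delta> \<epsilon> \<psi> p + b * scaled_hamiltonian N \<delta> \<epsilon> \<eta> p"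
    proof -
      have "cre1 (ann2 (\<lambda>p. a * \<psi> p + b * \<eta> p)) p = a * cre1 (ann2 \<psi>) p + b * cre1 (ann2 \<eta>) p"
        "cre2 (ann1 (\<lambda>p. a * \<psi> p + b * \<eta> p)) p = a * cre2 (ann1 \<psi>) p + b * cre2 (ann1 \<eta>) p"
        by (cases p; simp add: cre1_def cre2_def ann1_def ann2_def algebra_simps)+
      then show ?thesis by (simp only: scaled_hamiltonian_def algebra_simps)
    qed
  qed
qed auto

text \<open>The agreement is confined to \<open>boson_space N\<close>, since
  \<open>bose_hubbard_on\<close> is a \<open>restrict\<close>. Iterates stay in that space, so the
  two exponential series agree term by term.\<close>

lemma boltzmann_op_scaled:
  assumes N: "N \<ge> 1"
    and \<delta>: "real N * J / (kB * T) = \<delta>" and \<epsilon>: "(real N)\<^sup>2 * U / (2 * kB * T) = \<epsilon>"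
    and \<psi>: "\<psi> \<in> boson_space N"
  shows "boltzmann_op kB N J U T \<psi> = op_exp (scaled_hamiltonian N \<delta> \<epsilon>) \<psi>"
proof -
  interpret bounded_boson_op N "scaled_hamiltonian N \<delta> \<epsilon>" "1 + 2 * \<bar>\<delta>\<bar> + \<bar>\<epsilon>\<bar>"
    by (rule bounded_scaled_hamiltonian[OF N])
  have J: "J / (kB * T) = \<delta> / real N" using N \<delta> by (auto simp: field_simps)
  have U: "U / 2 / (kB * T) = \<epsilon> / (real N)\<^sup>2" using N \<epsilon> by (auto simp: field_simps)
  have step: "(\<lambda>p. - bose_hubbard_on N J U \<eta> p / complex_of_real (kB * T)) = scaled_hamiltonian N \<delta> \<epsilon> \<eta>"
    if \<eta>: "\<eta> \<in> boson_space N" for \<eta>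
  proof
    fix p
    have "- bose_hubbard_on N J U \<eta> p / complex_of_real (kB * T)
        = complex_of_real (J / (kB * T)) * (cre1 (ann2 \<eta>) p + cre2 (ann1 \<eta>) p)
          - complex_of_real (U / 2 / (kB * T)) * (complex_of_real (pair_count p) * \<eta> p)"
      using \<eta> by (simp add: bose_hubbard_on_def bose_hubbard_def interaction_diagonal
          diff_divide_distrib add_divide_distrib distrib_left)
    then show "- bose_hubbard_on N J U \<eta> p / complex_of_real (kB * T) = scaled_hamiltonian N \<delta> \<epsilon> \<eta> p"
      unfolding J U by (simp add: scaled_hamiltonian_def mult.assoc)
  qed
  have "((\<lambda>\<psi> p. - bose_hubbard_on N J U \<psi> p / complex_of_real (kB * T)) ^^ k) \<psi>
      = (scaled_hamiltonian N \<delta> \<epsilon> ^^ k) \<psi>" for k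
    using step[OF pow_closed[OF \<psi>]] by (induction k) simp_all
  then show ?thesis by (simp add: boltzmann_op_def op_exp_def)
qed

section \<open>Coherent states in the occupation basis\<close>

definition coh :: "nat \<Rightarrow> complex \<Rightarrow> complex \<Rightarrow> amplitudes" where
  "coh N \<alpha> \<beta> = (\<lambda>(m, n).
     if m + n = N then complex_of_real (sqrt (real (N choose m))) * \<alpha> ^ m * \<beta> ^ n else 0)"

lemma coh_boson_space [simp]: "coh N \<alpha> \<beta> \<in> boson_space N"
  by (auto simp: boson_space_iff coh_def)

text \<open>Arbitrary complex amplitudes in \<open>coh\<close> make the family closed under mode
  exchange, which the phase convention of \<open>coherent_state\<close> would not.\<close>

lemma swap_coh: "swap_modes (coh N \<alpha> \<beta>) = coh N \<beta> \<alpha>"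
proof
  fix p :: "nat \<times> nat"
  obtain m n where p: "p = (m, n)" by (cases p)
  show "swap_modes (coh N \<alpha> \<beta>) p = coh N \<beta> \<alpha> p"
    using binomial_symmetric[of m "m + n"] by (auto simp: p swap_modes_def coh_def add.commute)
qed

text \<open>In the induction step the two creation operators contribute m and n times the same
  coefficient; their sum m + n = N + 1 turns \<open>fact N\<close> into
  \<open>fact (Suc N)\<close>.\<close>

lemma creation_power_vacuum:
  "((\<lambda>\<psi> q. \<alpha> * cre1 \<psi> q + \<beta> * cre2 \<psi> q) ^^ N) vacuum (m, n) =
     (if m + n = N then complex_of_real (fact N / sqrt (fact m * fact n)) * \<alpha> ^ m * \<beta> ^ n else 0)"
proof (induction N arbitrary: m n)
  case 0
  show ?case by (simp add: vacuum_def occ_def)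
next
  case (Suc N)
  let ?f = "\<lambda>N m n. complex_of_real (fact N / sqrt (fact m * fact n)) * \<alpha> ^ m * \<beta> ^ n"
  have shift: "sqrt (real (Suc k)) * (fact N / sqrt (fact k * c)) = real (Suc k) * (fact N / sqrt (fact (Suc k) * c))"
    for k and c :: real
  proof -
    define s where "s = sqrt (real (Suc k))"
    have s0: "s > 0" by (simp add: s_def)
    have ss: "real (Suc k) = s * s" by (simp add: s_def)
    have eq: "sqrt (fact (Suc k) * c) = s * sqrt (fact k * c)"
      by (simp add: s_def real_sqrt_mult)
    show ?thesis unfolding s_def[symmetric] eq ss using s0 by simp
  qed
  have 1: "\<alpha> * (complex_of_real (sqrt (real m)) * ?f N (m - 1) n) = of_nat m * complex_of_real (fact N / sqrt (fact m * fact n)) * \<alpha> ^ m * \<beta> ^ n"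
  proof (cases m)
    case (Suc k)
    have "complex_of_real (sqrt (real (Suc k))) * complex_of_real (fact N / sqrt (fact k * fact n))
      = of_nat (Suc k) * complex_of_real (fact N / sqrt (fact (Suc k) * fact n))"
      using shift[of k "fact n"] by (metis of_real_mult of_real_of_nat_eq)
    moreover have "\<alpha> * (s * (g * x * y)) = (s * g) * (\<alpha> * x) * y" for s g x y by simp
    ultimately show ?thesis unfolding Suc power_Suc diff_Suc_1 by (simp only:)
  qed simp
  have 2: "\<beta> * (complex_of_real (sqrt (real n)) * ?f N m (n - 1)) = of_nat n * complex_of_real (fact N / sqrt (fact m * fact n)) * \<alpha> ^ m * \<beta> ^ n"
  proof (cases n)
    case (Suc k)
    have "complex_of_real (sqrt (real (Suc k))) * complex_of_real (fact N / sqrt (fact m * fact k))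
      = of_nat (Suc k) * complex_of_real (fact N / sqrt (fact m * fact (Suc k)))"
      using shift[of k "fact m"] by (metis of_real_mult of_real_of_nat_eq mult.commute)
    moreover have "\<beta> * (s * (g * x * y)) = (s * g) * x * (\<beta> * y)" for s g x y by simp
    ultimately show ?thesis unfolding Suc power_Suc diff_Suc_1 by (simp only:)
  qed simp
  let ?v = "((\<lambda>\<psi> q. \<alpha> * cre1 \<psi> q + \<beta> * cre2 \<psi> q) ^^ N) vacuum"
  have cre: "cre1 \<psi> (m, n) = complex_of_real (sqrt (real m)) * \<psi> (m - 1, n)"
    "cre2 \<psi> (m, n) = complex_of_real (sqrt (real n)) * \<psi> (m, n - 1)" for \<psi> m n
    by (simp_all add: cre1_def cre2_def)
  have v1: "cre1 ?v (m, n) = complex_of_real (sqrt (real m)) * (if m + n = Suc N then ?f N (m - 1) n else 0)"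
  proof (cases m)
    case (Suc k)
    then show ?thesis unfolding cre Suc.IH by simp
  qed (simp add: cre)
  have v2: "cre2 ?v (m, n) = complex_of_real (sqrt (real n)) * (if m + n = Suc N then ?f N m (n - 1) else 0)"
  proof (cases n)
    case (Suc k)
    then show ?thesis unfolding cre Suc.IH by simp
  qed (simp add: cre)
  have step: "((\<lambda>\<psi> q. \<alpha> * cre1 \<psi> q + \<beta> * cre2 \<psi> q) ^^ Suc N) vacuum (m, n)
      = \<alpha> * cre1 ?v (m, n) + \<beta> * cre2 ?v (m, n)" by simp
  show ?case
  proof (cases "m + n = Suc N")
    case True
    have "\<alpha> * cre1 ?v (m, n) + \<beta> * cre2 ?v (m, n)
        = of_nat (m + n) * complex_of_real (fact N / sqrt (fact m * fact n)) * \<alpha> ^ m * \<beta> ^ n"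
      unfolding v1 v2 if_P[OF True] 1 2 by (simp only: of_nat_add distrib_right)
    also have "\<dots> = ?f (Suc N) m n" unfolding True by (simp add: field_simps)
    finally show ?thesis unfolding step if_P[OF True] .
  next
    case False
    then show ?thesis unfolding step v1 v2 by simp
  qed
qed

lemma coherent_state_eq:
  "coherent_state N \<theta> \<phi> = coh N (complex_of_real (cos (\<theta> / 2)))
     (exp (\<i> * complex_of_real \<phi>) * complex_of_real (sin (\<theta> / 2)))"
proof
  fix p :: "nat \<times> nat"
  obtain m n where p: "p = (m, n)" by (cases p)
  have "fact N / sqrt (fact m * fact n) / sqrt (fact N) = sqrt (real (N choose m))" if "m + n = N"
  proof -
    have "real (N choose m) = fact N / (fact m * fact n)"
      using that binomial_fact[of m N, where 'a = real] by auto
    then have "sqrt (real (N choose m)) = sqrt (fact N) / sqrt (fact m * fact n)"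
      by (simp add: real_sqrt_divide)
    moreover have "fact N / sqrt (fact N) = (sqrt (fact N) :: real)" by (simp add: real_div_sqrt)
    moreover have "F / S / Q = F / Q / S" for F S Q :: real by simp
    ultimately show ?thesis by (simp only:)
  qed
  then have eq: "complex_of_real (fact N / sqrt (fact m * fact n)) / complex_of_real (sqrt (fact N))
      = complex_of_real (sqrt (real (N choose m)))" if "m + n = N"
    using that by (simp only: of_real_divide[symmetric])
  have "(if P then c * x * y else 0) / d = (if P then c / d * x * y else 0)" for P and c d x y :: complex
    by simp
  then show "coherent_state N \<theta> \<phi> p = coh N (complex_of_real (cos (\<theta> / 2)))
     (exp (\<i> * complex_of_real \<phi>) * complex_of_real (sin (\<theta> / 2))) p"
    unfolding coherent_state_def p creation_power_vacuum
    by (simp only: coh_def case_prod_conv eq cong: if_cong)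
qed

subsection \<open>Coherent states as approximate eigenvectors\<close>

text \<open>This is the variance of the empirical frequency m / N under the binomial distribution,
  obtained by expanding the square into the moments of m (m - 1), m and 1.\<close>

lemma bernstein_variance:
  assumes "N \<ge> 1"
  shows "(\<Sum>m\<le>N. Bernstein N m x * (real m / real N - x)\<^sup>2) = x * (1 - x) / real N"
proof -
  have "Bernstein N m x * (real m / real N - x)\<^sup>2
      = (1 / (real N)\<^sup>2) * (real m * (real m - 1) * Bernstein N m x)
        + (1 / (real N)\<^sup>2 - 2 * x / real N) * (real m * Bernstein N m x)
        + x\<^sup>2 * Bernstein N m x" for m
    using assms by (simp add: field_simps power2_eq_square)
  then have "(\<Sum>m\<le>N. Bernstein N m x * (real m / real N - x)\<^sup>2)
      = (1 / (real N)\<^sup>2) * (real N * (real N - 1) * x\<^sup>2)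
        + (1 / (real N)\<^sup>2 - 2 * x / real N) * (real N * x) + x\<^sup>2"
    by (simp only: sum.distrib sum_distrib_left[symmetric] sum_Bernstein sum_k_Bernstein
        sum_kk_Bernstein mult_1_right)
  also have "\<dots> = x * (1 - x) / real N"
    using assms by (simp add: field_simps power2_eq_square)
  finally show ?thesis .
qed

text \<open>The occupation of mode 1 is thus binomially distributed, which brings in
  \<open>bernstein_variance\<close>.\<close>

lemma cmod_coh_sq:
  assumes "m \<le> N" and unit: "(cmod \<alpha>)\<^sup>2 + (cmod \<beta>)\<^sup>2 = 1"
  shows "(cmod (coh N \<alpha> \<beta> (m, N - m)))\<^sup>2 = Bernstein N m ((cmod \<alpha>)\<^sup>2)"
proof -
  have "1 - (cmod \<alpha>)\<^sup>2 = (cmod \<beta>)\<^sup>2" using unit by simp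
  then show ?thesis using assms(1)
    by (simp add: coh_def Bernstein_def norm_mult norm_power power_mult_distrib)
      (simp flip: power_mult add: mult.commute)
qed

lemma bnorm_coh:
  assumes "(cmod \<alpha>)\<^sup>2 + (cmod \<beta>)\<^sup>2 = 1"
  shows "bnorm N (coh N \<alpha> \<beta>) = 1"
  by (simp add: bnorm_def L2_set_def cmod_coh_sq[OF _ assms])

text \<open>With x = m / N and p = |\<open>\<alpha>\<close>|^2, the scaled pair count is x^2 + (1 -
  x)^2 - 1 / N, so its deviation from p^2 + (1 - p)^2 is 2 (x + p - 1) (x - p) - 1 / N. The constant
  is 5 = 4 + 1: 4 bounds |2 (x + p - 1)|, and 1 / N is at most 1 / sqrt N.\<close>

lemma bnorm_diag_coh:
  assumes N: "N \<ge> 1" and unit: "(cmod \<alpha>)\<^sup>2 + (cmod \<beta>)\<^sup>2 = 1"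
  shows "bnorm N (\<lambda>p. complex_of_real (pair_count p / (real N)\<^sup>2 - ((cmod \<alpha>) ^ 4 + (cmod \<beta>) ^ 4))
    * coh N \<alpha> \<beta> p) \<le> 5 / sqrt (real N)"
proof -
  let ?p = "(cmod \<alpha>)\<^sup>2" and ?c = "\<lambda>m. cmod (coh N \<alpha> \<beta> (m, N - m))"
  define d where "d m = pair_count (m, N - m) / (real N)\<^sup>2 - ((cmod \<alpha>) ^ 4 + (cmod \<beta>) ^ 4)" for m
  have d: "\<bar>d m\<bar> \<le> 4 * \<bar>real m / real N - ?p\<bar> + 1 / real N" if m: "m \<le> N" for m
  proof -
    define x where "x = real m / real N"
    have x: "0 \<le> x" "x \<le> 1" using m N by (auto simp: x_def)
    have p: "0 \<le> ?p" "?p \<le> 1" using unit by (auto, smt (verit) zero_le_power2)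
    have q: "(cmod \<beta>) ^ 4 = (1 - ?p)\<^sup>2"
      using unit by (simp flip: power_mult add: eq_diff_eq[symmetric])
    have q': "(cmod \<alpha>) ^ 4 = ?p\<^sup>2" by (simp flip: power_mult)
    have "pair_count (m, N - m) / (real N)\<^sup>2 = x\<^sup>2 + (1 - x)\<^sup>2 - 1 / real N"
    proof -
      have "pair_count (m, N - m) = (real m)\<^sup>2 + (real N - real m)\<^sup>2 - real N"
        using m by (simp add: pair_count_def of_nat_diff algebra_simps power2_eq_square)
      moreover have "(real N - real m) / real N = 1 - x" "real N / (real N)\<^sup>2 = 1 / real N"
        using N by (simp_all add: x_def diff_divide_distrib power2_eq_square)
      ultimately show ?thesis
        by (simp only: add_divide_distrib diff_divide_distrib[of "_ + _"] power_divide[symmetric] x_def)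
    qed
    then have "d m = 2 * (x + ?p - 1) * (x - ?p) - 1 / real N"
      unfolding d_def q q' by (simp add: algebra_simps power2_eq_square)
    moreover have "\<bar>2 * (x + ?p - 1) * (x - ?p)\<bar> \<le> 4 * \<bar>x - ?p\<bar>"
    proof -
      have "\<bar>2 * (x + y - 1)\<bar> \<le> 4" if "0 \<le> y" "y \<le> 1" for y
        unfolding abs_le_iff using x that by simp
      from this[OF p] show ?thesis unfolding abs_mult[of _ "x - ?p"] by (intro mult_right_mono) auto
    qed
    moreover have "0 \<le> 1 / real N" by simp
    ultimately show ?thesis unfolding x_def[symmetric] by linarith
  qed
  have "L2_set (\<lambda>m. \<bar>d m\<bar> * ?c m) {..N}
      \<le> L2_set (\<lambda>m. 4 * (\<bar>real m / real N - ?p\<bar> * ?c m) + 1 / real N * ?c m) {..N}"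
  proof (rule L2_set_mono)
    fix m assume "m \<in> {..N}"
    then have "\<bar>d m\<bar> * ?c m \<le> (4 * \<bar>real m / real N - ?p\<bar> + 1 / real N) * ?c m"
      by (intro mult_right_mono d) auto
    then show "\<bar>d m\<bar> * ?c m \<le> 4 * (\<bar>real m / real N - ?p\<bar> * ?c m) + 1 / real N * ?c m"
      by (simp add: algebra_simps)
  qed auto
  also have "\<dots> \<le> 4 * L2_set (\<lambda>m. \<bar>real m / real N - ?p\<bar> * ?c m) {..N} + 1 / real N * L2_set ?c {..N}"
    by (rule order_trans[OF L2_set_triangle_ineq])
      (simp only: L2_set_right_distrib zero_le_numeral zero_le_divide_1_iff of_nat_0_le_iff order_refl)
  also have "L2_set ?c {..N} = 1" using bnorm_coh[OF unit, of N] by (simp add: bnorm_def)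
  also have "L2_set (\<lambda>m. \<bar>real m / real N - ?p\<bar> * ?c m) {..N} = sqrt (?p * (1 - ?p) / real N)"
    using bernstein_variance[OF N, of ?p]
    by (simp add: L2_set_def power_mult_distrib cmod_coh_sq[OF _ unit] mult.commute)
  also have "4 * sqrt (?p * (1 - ?p) / real N) + 1 / real N * 1 \<le> 4 * (1 / sqrt (real N)) + 1 / sqrt (real N)"
  proof (intro add_mono mult_left_mono)
    have "?p * (1 - ?p) \<le> 1 * 1"
    proof (rule mult_mono)
      show "?p \<le> 1" "0 \<le> 1 - ?p" using unit zero_le_power2[of "cmod \<beta>"] by linarith+
    qed auto
    then show "sqrt (?p * (1 - ?p) / real N) \<le> 1 / sqrt (real N)"
      using N by (simp add: real_sqrt_divide divide_right_mono)
    have "sqrt (real N) \<le> real N"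
      using N by (intro real_le_lsqrt) (auto simp: power2_eq_square)
    then show "1 / real N * 1 \<le> 1 / sqrt (real N)" using N by (simp add: frac_le)
  qed auto
  finally show ?thesis unfolding bnorm_def norm_mult norm_of_real d_def[symmetric] by simp
qed

text \<open>For nonzero a this is b^2 / a^2 times the Bernstein variance at a^2, that is b^4 / N.
  The form without division also covers a = 0.\<close>

lemma binomial_hop_sum:
  fixes a b :: real
  assumes N: "N \<ge> 1" and unit: "a\<^sup>2 + b\<^sup>2 = 1"
  shows "(\<Sum>m\<le>N. real (N choose m) * (real m / real N * a ^ (m - 1) - a ^ (m + 1))\<^sup>2 * (b ^ (N - m + 1))\<^sup>2)
    \<le> 1 / real N"
proof (cases "a = 0")
  case True
  then have b: "b\<^sup>2 = 1" using unit by simp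
  then have "(b ^ k)\<^sup>2 = 1" for k by (metis power_mult mult.commute power_one)
  then have "b ^ k * b ^ k = 1" "b * b ^ k * (b * b ^ k) = 1" for k
    by (metis power2_eq_square, metis power2_eq_square power_Suc)
  \<comment> \<open>At a = 0 only m = 1 survives, because 0^0 = 1; it contributes N * (1 /
    N)^2.\<close>
  then have "(\<Sum>m\<le>N. real (N choose m) * (real m / real N * a ^ (m - 1) - a ^ (m + 1))\<^sup>2 * (b ^ (N - m + 1))\<^sup>2)
      = (\<Sum>m\<le>N. if m = 1 then 1 / real N else 0)"
    using N True by (intro sum.cong) (auto simp: power_0_left power2_eq_square)
  then show ?thesis using N by simp
next
  case False
  have eq: "1 - a\<^sup>2 = b\<^sup>2" using unit by simp
  have "real (N choose m) * (real m / real N * a ^ (m - 1) - a ^ (m + 1))\<^sup>2 * (b ^ (N - m + 1))\<^sup>2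
      = b\<^sup>2 / a\<^sup>2 * (Bernstein N m (a\<^sup>2) * (real m / real N - a\<^sup>2)\<^sup>2)" for m
  proof -
    have "real m / real N * a ^ (m - 1) - a ^ (m + 1) = a ^ m / a * (real m / real N - a\<^sup>2)"
      using False by (cases m) (auto simp: field_simps power2_eq_square)
    then show ?thesis
      by (simp add: Bernstein_def eq power_mult_distrib power_divide flip: power_mult) (simp add: mult.commute)
  qed
  then have "(\<Sum>m\<le>N. real (N choose m) * (real m / real N * a ^ (m - 1) - a ^ (m + 1))\<^sup>2 * (b ^ (N - m + 1))\<^sup>2)
      = b\<^sup>2 / a\<^sup>2 * (a\<^sup>2 * (1 - a\<^sup>2) / real N)"
    by (simp only: bernstein_variance[OF N] sum_distrib_left[symmetric])
  also have "\<dots> = b\<^sup>2 * b\<^sup>2 / real N" using False by (simp add: eq)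
  also have "\<dots> \<le> 1 * 1 / real N"
    using unit by (intro divide_right_mono mult_mono) (auto, (smt (verit) zero_le_power2)+)
  finally show ?thesis by simp
qed

text \<open>Hopping multiplies the m-th coefficient formally by m \<open>\<beta> / \<alpha>\<close>.
  After division by N, replacing m / N by its mean |\<open>\<alpha>\<close>|^2 gives the eigenvalue
  \<open>cnj \<alpha> * \<beta>\<close>.\<close>

lemma bnorm_hop_coh:
  assumes N: "N \<ge> 1" and unit: "(cmod \<alpha>)\<^sup>2 + (cmod \<beta>)\<^sup>2 = 1"
  shows "bnorm N (\<lambda>p. cre1 (ann2 (coh N \<alpha> \<beta>)) p / of_nat N - cnj \<alpha> * \<beta> * coh N \<alpha> \<beta> p) \<le> 1 / sqrt (real N)"
proof -
  have sq: "(cmod (cre1 (ann2 (coh N \<alpha> \<beta>)) (m, N - m) / of_nat N - cnj \<alpha> * \<beta> * coh N \<alpha> \<beta> (m, N - m)))\<^sup>2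
      = real (N choose m) * (real m / real N * cmod \<alpha> ^ (m - 1) - cmod \<alpha> ^ (m + 1))\<^sup>2 * (cmod \<beta> ^ (N - m + 1))\<^sup>2"
    if m: "m \<le> N" for m
  proof -
    \<comment> \<open>For m = k + 1 the square roots combine by (k + 1) C(N, k + 1) = (N - k) C(N,
      k).\<close>
    have hop: "cre1 (ann2 (coh N \<alpha> \<beta>)) (m, N - m)
        = of_nat m * complex_of_real (sqrt (real (N choose m))) * \<alpha> ^ (m - 1) * \<beta> ^ (N - m + 1)"
    proof (cases m)
      case 0
      then show ?thesis by (simp add: cre1_def)
    next
      case (Suc k)
      then have k: "k < N" using m by simp
      have "real (Suc k) * real (N choose Suc k) = real (N - k) * real (N choose k)"
        using k binomial_absorb_comp[of N k] binomial_absorption[of k "N"]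
        by (metis Suc_times_binomial_add binomial_absorption of_nat_mult)
      then have "(real (Suc k) * real (N - k)) * real (N choose k) = (real (Suc k))\<^sup>2 * real (N choose Suc k)"
        by (simp add: power2_eq_square)
      then have "sqrt (real (Suc k)) * sqrt (real (N - k)) * sqrt (real (N choose k)) = real (Suc k) * sqrt (real (N choose Suc k))"
        by (metis real_sqrt_mult real_sqrt_abs abs_of_nat)
      then have "complex_of_real (sqrt (real (Suc k))) * complex_of_real (sqrt (real (N - k))) * complex_of_real (sqrt (real (N choose k)))
          = of_nat (Suc k) * complex_of_real (sqrt (real (N choose Suc k)))"
        by (metis of_real_mult of_real_of_nat_eq)
      moreover have nk: "N - Suc k + 1 = N - k" using k by simp
      have "cre1 (ann2 (coh N \<alpha> \<beta>)) (Suc k, N - Suc k)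
          = complex_of_real (sqrt (real (Suc k))) * (complex_of_real (sqrt (real (N - k))) *
            (complex_of_real (sqrt (real (N choose k))) * \<alpha> ^ k * \<beta> ^ (N - k)))"
        using k unfolding cre1_def ann2_def case_prod_conv diff_Suc_1 nk by (simp add: coh_def)
      moreover have "s * (t * (u * x * y)) = (s * t * u) * x * y" for s t u x y :: complex by simp
      ultimately show ?thesis unfolding Suc diff_Suc_1 nk by (simp only:)
    qed
    have "cre1 (ann2 (coh N \<alpha> \<beta>)) (m, N - m) / of_nat N - cnj \<alpha> * \<beta> * coh N \<alpha> \<beta> (m, N - m)
        = complex_of_real (sqrt (real (N choose m))) * (complex_of_real (real m / real N) * \<alpha> ^ (m - 1) - cnj \<alpha> * \<alpha> ^ m) * \<beta> ^ (N - m + 1)"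
      unfolding hop using m by (simp add: coh_def algebra_simps)
    moreover have "cmod (complex_of_real (real m / real N) * \<alpha> ^ (m - 1) - cnj \<alpha> * \<alpha> ^ m)
        = \<bar>real m / real N * cmod \<alpha> ^ (m - 1) - cmod \<alpha> ^ (m + 1)\<bar>"
    proof (cases m)
      case (Suc k)
      have "cnj \<alpha> * \<alpha> = complex_of_real ((cmod \<alpha>)\<^sup>2)"
        by (metis complex_norm_square mult.commute)
      then have "complex_of_real (real m / real N) * \<alpha> ^ (m - 1) - cnj \<alpha> * \<alpha> ^ m
          = complex_of_real (real m / real N - (cmod \<alpha>)\<^sup>2) * \<alpha> ^ k"
        unfolding Suc power_Suc mult.assoc[symmetric] by (simp add: algebra_simps)
      moreover have "real m / real N * cmod \<alpha> ^ (m - 1) - cmod \<alpha> ^ (m + 1)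
          = (real m / real N - (cmod \<alpha>)\<^sup>2) * cmod \<alpha> ^ k"
        unfolding Suc by (simp add: algebra_simps power2_eq_square)
      ultimately show ?thesis
        by (simp only: norm_mult norm_of_real norm_power abs_mult) simp
    qed simp
    ultimately show ?thesis by (simp add: norm_mult norm_power power_mult_distrib)
  qed
  have "(\<Sum>m\<le>N. (cmod (cre1 (ann2 (coh N \<alpha> \<beta>)) (m, N - m) / of_nat N
      - cnj \<alpha> * \<beta> * coh N \<alpha> \<beta> (m, N - m)))\<^sup>2) \<le> 1 / real N"
    by (rule ord_eq_le_trans[OF sum.cong[OF refl sq] binomial_hop_sum[OF N unit]]) simp
  then have "bnorm N (\<lambda>p. cre1 (ann2 (coh N \<alpha> \<beta>)) p / of_nat N - cnj \<alpha> * \<beta> * coh N \<alpha> \<beta> p) \<le> sqrt (1 / real N)"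
    unfolding bnorm_def L2_set_def by (rule real_sqrt_le_mono)
  then show ?thesis by (simp only: real_sqrt_divide real_sqrt_one)
qed

text \<open>The two hopping directions have complex conjugate approximate eigenvalues, whose sum
  gives the real part in \<open>h\<close>. Each contributes an error 1 / sqrt N, and the diagonal
  part contributes 5 / sqrt N.\<close>

lemma scaled_hamiltonian_near_symbol:
  fixes \<delta> \<epsilon> :: real
  assumes N: "N \<ge> 1" and unit: "(cmod \<alpha>)\<^sup>2 + (cmod \<beta>)\<^sup>2 = 1"
  defines "h \<equiv> complex_of_real (\<delta> * (2 * Re (cnj \<alpha> * \<beta>)) - \<epsilon> * ((cmod \<alpha>) ^ 4 + (cmod \<beta>) ^ 4))"
  shows "bnorm N (\<lambda>p. scaled_hamiltonian N \<delta> \<epsilon> (coh N \<alpha> \<beta>) p - h * coh N \<alpha> \<beta> p)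
    \<le> (2 * \<bar>\<delta>\<bar> + 5 * \<bar>\<epsilon>\<bar>) / sqrt (real N)"
proof -
  let ?\<Psi> = "coh N \<alpha> \<beta>"
  define X where "X = (\<lambda>p. cre1 (ann2 ?\<Psi>) p / of_nat N - cnj \<alpha> * \<beta> * ?\<Psi> p)"
  define Y where "Y = (\<lambda>p. cre2 (ann1 ?\<Psi>) p / of_nat N - cnj \<beta> * \<alpha> * ?\<Psi> p)"
  define D where "D = (\<lambda>p. complex_of_real (pair_count p / (real N)\<^sup>2 - ((cmod \<alpha>) ^ 4 + (cmod \<beta>) ^ 4)) * ?\<Psi> p)"
  have X: "bnorm N X \<le> 1 / sqrt (real N)"
    unfolding X_def by (rule bnorm_hop_coh[OF N unit])
  have "Y = swap_modes (\<lambda>p. cre1 (ann2 (coh N \<beta> \<alpha>)) p / of_nat N - cnj \<beta> * \<alpha> * coh N \<beta> \<alpha> p)"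
    unfolding Y_def cre2_ann1_swap swap_coh using swap_coh[of N \<beta> \<alpha>]
    by (auto simp: swap_modes_def fun_eq_iff)
  then have Y: "bnorm N Y \<le> 1 / sqrt (real N)"
    using bnorm_hop_coh[OF N, of \<beta> \<alpha>] unit by (simp add: add.commute)
  have D: "bnorm N D \<le> 5 / sqrt (real N)"
    unfolding D_def by (rule bnorm_diag_coh[OF N unit])
  have re: "complex_of_real (2 * Re (cnj \<alpha> * \<beta>)) = cnj \<alpha> * \<beta> + cnj \<beta> * \<alpha>"
    using complex_add_cnj[of "cnj \<alpha> * \<beta>"] by (simp add: mult.commute)
  have "(\<lambda>p. scaled_hamiltonian N \<delta> \<epsilon> ?\<Psi> p - h * ?\<Psi> p)
      = (\<lambda>p. complex_of_real \<delta> * (\<lambda>q. X q + Y q) p + complex_of_real (- \<epsilon>) * D p)"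
    unfolding h_def of_real_diff of_real_mult[of \<delta>] re X_def Y_def D_def scaled_hamiltonian_def
    by (auto simp: fun_eq_iff algebra_simps)
  then have "bnorm N (\<lambda>p. scaled_hamiltonian N \<delta> \<epsilon> ?\<Psi> p - h * ?\<Psi> p)
      \<le> \<bar>\<delta>\<bar> * bnorm N (\<lambda>q. X q + Y q) + \<bar>\<epsilon>\<bar> * bnorm N D"
    using bnorm_add[of N "\<lambda>p. complex_of_real \<delta> * (\<lambda>q. X q + Y q) p" "\<lambda>p. complex_of_real (- \<epsilon>) * D p"]
    by (simp only: bnorm_scale norm_of_real) simp
  also have "\<dots> \<le> \<bar>\<delta>\<bar> * (1 / sqrt (real N) + 1 / sqrt (real N)) + \<bar>\<epsilon>\<bar> * (5 / sqrt (real N))"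
    by (intro add_mono mult_left_mono D order_trans[OF bnorm_add] X Y) auto
  also have "\<dots> = (2 * \<bar>\<delta>\<bar> + 5 * \<bar>\<epsilon>\<bar>) / sqrt (real N)"
    by (simp add: add_divide_distrib mult.commute)
  finally show ?thesis .
qed

subsection \<open>Resolution of the identity\<close>

text \<open>The substitution u = cos^2 (\<open>\<theta>\<close> / 2) shows this to be twice the Beta
  integral B(m + 1, n + 1). The induction integrates by parts, trading a sine square for a cosine
  square, so m must stay arbitrary.\<close>

lemma has_integral_cos_sin_power:
  "((\<lambda>\<theta>. cos (\<theta> / 2) ^ (2 * m) * sin (\<theta> / 2) ^ (2 * n) * sin \<theta>) has_integral
     (2 * fact m * fact n / fact (m + n + 1))) {0..pi :: real}"
proof (induction n arbitrary: m)
  case 0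
  let ?F = "\<lambda>\<theta>. - 2 / real (m + 1) * cos (\<theta> / 2) ^ (2 * m + 2)"
  have "(?F has_vector_derivative cos (\<theta> / 2) ^ (2 * m) * sin (\<theta> / 2) ^ (2 * 0) * sin \<theta>)
      (at \<theta> within {0..pi})" for \<theta> :: real
  proof -
    have "(?F has_real_derivative - 2 / real (m + 1) *
        (real (2 * m + 2) * cos (\<theta> / 2) ^ (2 * m + 1) * (- sin (\<theta> / 2) * (1 / 2)))) (at \<theta> within {0..pi})"
      by (rule DERIV_cmult) (rule derivative_eq_intros refl | simp)+
    moreover have "- 2 / real (m + 1) *
        (real (2 * m + 2) * cos (\<theta> / 2) ^ (2 * m + 1) * (- sin (\<theta> / 2) * (1 / 2)))
        = cos (\<theta> / 2) ^ (2 * m) * sin (\<theta> / 2) ^ (2 * 0) * sin \<theta>"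
    proof -
      define M where "M = real (m + 1)"
      have M: "M > 0" "real (2 * m + 2) = 2 * M" by (simp_all add: M_def)
      show ?thesis
        unfolding M(2) M_def[symmetric] using M(1) sin_double[of "\<theta> / 2"] by simp
    qed
    ultimately show ?thesis by (simp add: has_real_derivative_iff_has_vector_derivative)
  qed
  then have "((\<lambda>\<theta>. cos (\<theta> / 2) ^ (2 * m) * sin (\<theta> / 2) ^ (2 * 0) * sin \<theta>) has_integral
      (?F pi - ?F 0)) {0..pi}"
    by (intro fundamental_theorem_of_calculus) auto
  moreover have "?F pi - ?F 0 = 2 * fact m * fact 0 / fact (m + 0 + 1)"
  proof -
    have "fact (m + 0 + 1) = real (m + 1) * fact m" by simp
    then show ?thesis by simp
  qed
  ultimately show ?case by (simp only:)
next
  case (Suc n)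
  \<comment> \<open>The boundary term of the integration by parts: it vanishes at 0 by the sine and
    at pi by the cosine.\<close>
  let ?G = "\<lambda>\<theta>. - 2 / real (m + 1) * (cos (\<theta> / 2) ^ (2 * m + 2) * sin (\<theta> / 2) ^ (2 * n + 2))"
  let ?f = "\<lambda>m n \<theta>. cos (\<theta> / 2) ^ (2 * m) * sin (\<theta> / 2) ^ (2 * n) * sin \<theta>"
  let ?r = "real (n + 1) / real (m + 1)"
  have "(?G has_vector_derivative ?f m (Suc n) \<theta> - ?r * ?f (Suc m) n \<theta>) (at \<theta> within {0..pi})"
    for \<theta> :: real
  proof -
    have "(?G has_real_derivative - 2 / real (m + 1) *
        ((real (2 * m + 2) * cos (\<theta> / 2) ^ (2 * m + 1) * (- sin (\<theta> / 2) * (1 / 2))) * sin (\<theta> / 2) ^ (2 * n + 2)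
         + (real (2 * n + 2) * sin (\<theta> / 2) ^ (2 * n + 1) * (cos (\<theta> / 2) * (1 / 2))) * cos (\<theta> / 2) ^ (2 * m + 2)))
        (at \<theta> within {0..pi})"
      by (rule derivative_eq_intros refl | simp)+
    moreover have "- 2 / real (m + 1) *
        ((real (2 * m + 2) * cos (\<theta> / 2) ^ (2 * m + 1) * (- sin (\<theta> / 2) * (1 / 2))) * sin (\<theta> / 2) ^ (2 * n + 2)
         + (real (2 * n + 2) * sin (\<theta> / 2) ^ (2 * n + 1) * (cos (\<theta> / 2) * (1 / 2))) * cos (\<theta> / 2) ^ (2 * m + 2))
        = ?f m (Suc n) \<theta> - ?r * ?f (Suc m) n \<theta>"
    proof -
      define M where "M = real (m + 1)"
      have M: "M > 0" "real (2 * m + 2) = 2 * M" by (simp_all add: M_def)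
      define K where "K = real (n + 1)"
      have K: "real (2 * n + 2) = 2 * K" by (simp add: K_def)
      have th: "sin \<theta> = 2 * sin (\<theta> / 2) * cos (\<theta> / 2)" using sin_double[of "\<theta> / 2"] by simp
      show ?thesis
        unfolding M(2) K M_def[symmetric] K_def[symmetric] th
        using M(1) by (simp add: field_simps)
    qed
    ultimately show ?thesis by (simp add: has_real_derivative_iff_has_vector_derivative)
  qed
  then have "((\<lambda>\<theta>. ?f m (Suc n) \<theta> - ?r * ?f (Suc m) n \<theta>) has_integral (?G pi - ?G 0)) {0..pi}"
    by (intro fundamental_theorem_of_calculus) auto
  then have "((\<lambda>\<theta>. (?f m (Suc n) \<theta> - ?r * ?f (Suc m) n \<theta>) + ?r * ?f (Suc m) n \<theta>) has_integral
      (?G pi - ?G 0) + ?r * (2 * fact (Suc m) * fact n / fact (Suc m + n + 1))) {0..pi}"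
    by (intro has_integral_add has_integral_mult_right Suc.IH)
  moreover have "(?G pi - ?G 0) + ?r * (2 * fact (Suc m) * fact n / fact (Suc m + n + 1))
      = 2 * fact m * fact (Suc n) / fact (m + Suc n + 1)"
    by (simp add: divide_simps)
  ultimately show ?case by (simp only: diff_add_cancel)
qed

text \<open>Orthogonality of characters removes the off-diagonal terms, so only diagonal polar
  integrals have to be evaluated.\<close>

lemma has_integral_phase_factor:
  "((\<lambda>\<phi>. cnj (exp (\<i> * complex_of_real \<phi>)) ^ k * exp (\<i> * complex_of_real \<phi>) ^ l) has_integral
     (if k = l then complex_of_real (2 * pi) else 0)) {0..2 * pi}"
proof -
  define j where "j = \<i> * (of_nat l - of_nat k)"
  have eq: "cnj (exp (\<i> * complex_of_real \<phi>)) ^ k * exp (\<i> * complex_of_real \<phi>) ^ l = exp (j * complex_of_real \<phi>)" for \<phi>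
    by (simp add: exp_cnj j_def algebra_simps exp_diff exp_minus power_inverse divide_inverse flip: exp_of_nat_mult)
  show ?thesis
  proof (cases "k = l")
    case True
    then show ?thesis
      using has_integral_const_real[of "1::complex" 0 "2 * pi"]
      unfolding eq by (simp add: j_def scaleR_conv_of_real)
  next
    case False
    then have j: "j \<noteq> 0" by (simp add: j_def)
    have "((\<lambda>\<phi>. exp (j * complex_of_real \<phi>) / j) has_vector_derivative exp (j * complex_of_real \<phi>)) (at \<phi> within {0..2 * pi})" for \<phi>
      by (rule has_vector_derivative_real_field)
        (use j in \<open>auto intro!: derivative_eq_intros\<close>)
    then have "((\<lambda>\<phi>. exp (j * complex_of_real \<phi>)) has_integral
        (exp (j * complex_of_real (2 * pi)) / j - exp (j * complex_of_real 0) / j)) {0..2 * pi}"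
      by (intro fundamental_theorem_of_calculus) auto
    moreover have "exp (j * complex_of_real (2 * pi)) = 1"
      using exp_integer_2pi[of "of_int (int l - int k)"] by (simp add: j_def mult_ac)
    ultimately show ?thesis using False by (simp add: eq)
  qed
qed

lemma coherent_state_coord:
  assumes "m \<le> N"
  shows "coherent_state N \<theta> \<phi> (m, N - m) = complex_of_real
    (sqrt (real (N choose m)) * cos (\<theta> / 2) ^ m * sin (\<theta> / 2) ^ (N - m)) * exp (\<i> * complex_of_real \<phi>) ^ (N - m)"
  using assms by (simp add: coherent_state_eq coh_def power_mult_distrib)

definition overlap :: "nat \<Rightarrow> nat \<Rightarrow> nat \<Rightarrow> real \<Rightarrow> real" where
  "overlap N m l \<theta> = (sqrt (real (N choose m)) * cos (\<theta> / 2) ^ m * sin (\<theta> / 2) ^ (N - m)) *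
     (sqrt (real (N choose l)) * cos (\<theta> / 2) ^ l * sin (\<theta> / 2) ^ (N - l)) * sin \<theta>"

text \<open>The binomial coefficient cancels the Beta integral up to a factor independent of m;
  hence the averaged projector is a multiple of the identity.\<close>

lemma integral_overlap_diag:
  assumes "m \<le> N"
  shows "integral {0..pi} (overlap N m m) = 2 / real (N + 1)"
proof -
  have "overlap N m m = (\<lambda>\<theta>. real (N choose m) * (cos (\<theta> / 2) ^ (2 * m) * sin (\<theta> / 2) ^ (2 * (N - m)) * sin \<theta>))"
  proof
    fix \<theta>
    have "s * a * b * (s * a * b) * t = (s * s) * ((a * a) * (b * b) * t)" for s a b t :: real
      by simp
    then show "overlap N m m \<theta> = real (N choose m) * (cos (\<theta> / 2) ^ (2 * m) * sin (\<theta> / 2) ^ (2 * (N - m)) * sin \<theta>)"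
      unfolding overlap_def by (simp add: power_mult power2_eq_square power_mult_distrib)
  qed
  then have "(overlap N m m has_integral real (N choose m) * (2 * fact m * fact (N - m) / fact (m + (N - m) + 1))) {0..pi}"
    using has_integral_mult_right[OF has_integral_cos_sin_power] by simp
  moreover have "real (N choose m) * (2 * fact m * fact (N - m) / fact (m + (N - m) + 1)) = 2 / real (N + 1)"
  proof -
    have "real (N choose m) = fact N / (fact m * fact (N - m))"
      using binomial_fact[OF assms, where 'a = real] by simp
    moreover have "fact (m + (N - m) + 1) = real (N + 1) * fact N" using assms by simp
    ultimately show ?thesis by simp
  qed
  ultimately show ?thesis by (simp add: integral_unique)
qed

lemma has_integral_polar:
  assumes "m \<le> N" "l \<le> N"
  shows "((\<lambda>\<theta>. cnj (coherent_state N \<theta> \<phi> (m, N - m)) * coherent_state N \<theta> \<phi> (l, N - l) * complex_of_real (sin \<theta>))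
    has_integral (cnj (exp (\<i> * complex_of_real \<phi>)) ^ (N - m) * exp (\<i> * complex_of_real \<phi>) ^ (N - l))
      * complex_of_real (integral {0..pi} (overlap N m l))) {0..pi}"
proof -
  have "continuous_on {0..pi} (overlap N m l)"
    unfolding overlap_def by (intro continuous_intros) auto
  then have "(overlap N m l has_integral integral {0..pi} (overlap N m l)) {0..pi}"
    by (intro integrable_integral integrable_continuous_real)
  then have "((\<lambda>\<theta>. (cnj (exp (\<i> * complex_of_real \<phi>)) ^ (N - m) * exp (\<i> * complex_of_real \<phi>) ^ (N - l))
      * complex_of_real (overlap N m l \<theta>)) has_integral
      (cnj (exp (\<i> * complex_of_real \<phi>)) ^ (N - m) * exp (\<i> * complex_of_real \<phi>) ^ (N - l))
      * complex_of_real (integral {0..pi} (overlap N m l))) {0..pi}"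
    by (intro has_integral_mult_right has_integral_of_real)
  moreover have "cnj (coherent_state N \<theta> \<phi> (m, N - m)) * coherent_state N \<theta> \<phi> (l, N - l) * complex_of_real (sin \<theta>)
      = (cnj (exp (\<i> * complex_of_real \<phi>)) ^ (N - m) * exp (\<i> * complex_of_real \<phi>) ^ (N - l))
      * complex_of_real (overlap N m l \<theta>)" for \<theta>
  proof -
    have "cnj (complex_of_real u * x) * (complex_of_real v * y) * complex_of_real t
        = (cnj x * y) * complex_of_real (u * v * t)" for u v t x y
      by simp
    then show ?thesis
      unfolding coherent_state_coord[OF assms(1)] coherent_state_coord[OF assms(2)] overlap_def complex_cnj_power[symmetric] .
  qed
  ultimately show ?thesis by (simp only:)
qed

context bounded_boson_op
begin

text \<open>Besides the value, this supplies the integrability in \<open>\<theta>\<close> needed to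
  compare with the classical integral.\<close>

lemma has_integral_inner_op_exp:
  "((\<lambda>\<theta>. fock_inner (coherent_state N \<theta> \<phi>) (op_exp A (coherent_state N \<theta> \<phi>)) * complex_of_real (sin \<theta>))
    has_integral (\<Sum>m\<le>N. \<Sum>l\<le>N. (cnj (exp (\<i> * complex_of_real \<phi>)) ^ (N - m) * exp (\<i> * complex_of_real \<phi>) ^ (N - l))
      * complex_of_real (integral {0..pi} (overlap N m l)) * op_exp A (occ l (N - l)) (m, N - m))) {0..pi}"
proof -
  have "fock_inner (coherent_state N \<theta> \<phi>) (op_exp A (coherent_state N \<theta> \<phi>)) * complex_of_real (sin \<theta>)
      = (\<Sum>m\<le>N. \<Sum>l\<le>N. cnj (coherent_state N \<theta> \<phi> (m, N - m)) * coherent_state N \<theta> \<phi> (l, N - l) * complex_of_real (sin \<theta>)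
          * op_exp A (occ l (N - l)) (m, N - m))" for \<theta>
  proof -
    have \<Psi>: "coherent_state N \<theta> \<phi> \<in> boson_space N" by (simp add: coherent_state_eq)
    show ?thesis
      unfolding fock_inner_boson_space[OF \<Psi>] op_exp_matrix[OF \<Psi>] sum_distrib_left sum_distrib_right
      by (simp only: mult_ac)
  qed
  then show ?thesis
    by (simp only:) (intro has_integral_sum has_integral_mult_left has_integral_polar; simp)
qed

text \<open>This is the resolution of the identity by coherent states: \<open>(N + 1) / (4 * pi)\<close> times the
  integral of \<open>|\<Psi>\<rangle>\<langle>\<Psi>|\<close> over the sphere is the identity of the \<open>N\<close>-boson space.\<close>

lemma trace_op_exp_resolution:
  "((\<lambda>\<phi>. integral {0..pi} (\<lambda>\<theta>. fock_inner (coherent_state N \<theta> \<phi>) (op_exp A (coherent_state N \<theta> \<phi>)) * complex_of_real (sin \<theta>)))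
    has_integral complex_of_real (4 * pi / real (N + 1)) * trace_on N (op_exp A)) {0..2 * pi}"
proof -
  let ?W = "\<lambda>m l. complex_of_real (integral {0..pi} (overlap N m l)) * op_exp A (occ l (N - l)) (m, N - m)"
  have "((\<lambda>\<phi>. \<Sum>m\<le>N. \<Sum>l\<le>N. (cnj (exp (\<i> * complex_of_real \<phi>)) ^ (N - m) * exp (\<i> * complex_of_real \<phi>) ^ (N - l)) * ?W m l)
    has_integral (\<Sum>m\<le>N. \<Sum>l\<le>N. (if N - m = N - l then complex_of_real (2 * pi) else 0) * ?W m l)) {0..2 * pi}"
    by (intro has_integral_sum has_integral_mult_left has_integral_phase_factor finite_atMost)
  moreover have "(\<Sum>m\<le>N. \<Sum>l\<le>N. (if N - m = N - l then complex_of_real (2 * pi) else 0) * ?W m l)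
      = complex_of_real (4 * pi / real (N + 1)) * trace_on N (op_exp A)"
  proof -
    have "(\<Sum>l\<le>N. (if N - m = N - l then complex_of_real (2 * pi) else 0) * ?W m l)
        = complex_of_real (4 * pi / real (N + 1)) * fock_inner (occ m (N - m)) (op_exp A (occ m (N - m)))"
      if m: "m \<le> N" for m
    proof -
      \<comment> \<open>Both indices are at most N, so equality of the truncated differences forces
        l = m.\<close>
      have "(\<Sum>l\<le>N. (if N - m = N - l then complex_of_real (2 * pi) else 0) * ?W m l)
          = (\<Sum>l\<le>N. if l = m then complex_of_real (2 * pi) * ?W m l else 0)"
        using m by (intro sum.cong) auto
      also have "\<dots> = complex_of_real (2 * pi) * ?W m m" using m by simp
      also have "\<dots> = complex_of_real (2 * pi * (2 / real (N + 1))) * op_exp A (occ m (N - m)) (m, N - m)"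
        unfolding integral_overlap_diag[OF m] by simp
      finally show ?thesis by (simp add: fock_inner_occ[OF m])
    qed
    then show ?thesis by (simp add: trace_on_def sum_distrib_left)
  qed
  moreover have "integral {0..pi} (\<lambda>\<theta>. fock_inner (coherent_state N \<theta> \<phi>) (op_exp A (coherent_state N \<theta> \<phi>)) * complex_of_real (sin \<theta>))
     = (\<Sum>m\<le>N. \<Sum>l\<le>N. (cnj (exp (\<i> * complex_of_real \<phi>)) ^ (N - m) * exp (\<i> * complex_of_real \<phi>) ^ (N - l)) * ?W m l)" for \<phi>
    using integral_unique[OF has_integral_inner_op_exp] by (simp only: mult.assoc)
  ultimately show ?thesis by (simp only:)
qed

end

subsection \<open>The limit\<close>

lemma continuous_double_integral:
  fixes f :: "real \<Rightarrow> real \<Rightarrow> real"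
  assumes "continuous_on UNIV (\<lambda>(\<phi>, \<theta>). f \<phi> \<theta>)"
  shows "continuous_on {a..b} (f \<phi>)" "continuous_on S (\<lambda>\<phi>. integral {a..b} (f \<phi>))"
proof -
  show "continuous_on {a..b} (f \<phi>)"
    using continuous_on_compose2[OF assms, of "{a..b}" "\<lambda>\<theta>. (\<phi>, \<theta>)"]
    by (simp add: continuous_on_Pair)
  show "continuous_on S (\<lambda>\<phi>. integral {a..b} (f \<phi>))"
    using integral_continuous_on_param[of S a b f] continuous_on_subset[OF assms] by (simp add: box_real)
qed

text \<open>The weight \<open>sin \<theta>\<close> is to be absorbed into \<open>F\<close> and
  \<open>g\<close>, so the factor is the area of the parameter rectangle.\<close>

lemma double_integral_close:
  fixes F :: "real \<Rightarrow> real \<Rightarrow> complex" and g :: "real \<Rightarrow> real \<Rightarrow> real"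
  assumes inner: "\<And>\<phi>. (F \<phi>) integrable_on {0..pi}"
    and outer: "((\<lambda>\<phi>. integral {0..pi} (F \<phi>)) has_integral I) {0..2 * pi}"
    and g: "continuous_on UNIV (\<lambda>(\<phi>, \<theta>). g \<phi> \<theta>)"
    and close: "\<And>\<phi> \<theta>. cmod (F \<phi> \<theta> - complex_of_real (g \<phi> \<theta>)) \<le> B"
  shows "cmod (I - complex_of_real (integral {0..2 * pi} (\<lambda>\<phi>. integral {0..pi} (g \<phi>)))) \<le> B * pi * (2 * pi)"
proof -
  have B: "0 \<le> B" using close[of 0 0] norm_ge_zero order_trans by blast
  note gc = continuous_double_integral[OF g]
  have "cmod (integral {0..pi} (F \<phi>) - complex_of_real (integral {0..pi} (g \<phi>))) \<le> B * pi" for \<phi>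
  proof -
    have "((\<lambda>\<theta>. F \<phi> \<theta> - complex_of_real (g \<phi> \<theta>)) has_integral
        integral {0..pi} (F \<phi>) - complex_of_real (integral {0..pi} (g \<phi>))) {0..pi}"
      by (intro has_integral_diff has_integral_of_real integrable_integral inner
          integrable_continuous_real gc)
    then show ?thesis
      using has_integral_bound[OF B, of "\<lambda>\<theta>. F \<phi> \<theta> - complex_of_real (g \<phi> \<theta>)" _ 0 pi] close by simp
  qed
  moreover have "((\<lambda>\<phi>. integral {0..pi} (F \<phi>) - complex_of_real (integral {0..pi} (g \<phi>))) has_integral
      I - complex_of_real (integral {0..2 * pi} (\<lambda>\<phi>. integral {0..pi} (g \<phi>)))) {0..2 * pi}"
    by (intro has_integral_diff has_integral_of_real outer integrable_integral
        integrable_continuous_real gc)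
  ultimately show ?thesis
    using has_integral_bound[of "B * pi" "\<lambda>\<phi>. integral {0..pi} (F \<phi>) - complex_of_real (integral {0..pi} (g \<phi>))" _ 0 "2 * pi"] B
    by simp
qed

text \<open>The integrand vanishes at the poles, so the lower bound \<open>exp (- c)\<close> is
  integrated against the sine, whose integral is 2.\<close>

lemma double_integral_exp_pos:
  fixes g :: "real \<Rightarrow> real \<Rightarrow> real"
  assumes g: "continuous_on UNIV (\<lambda>(\<phi>, \<theta>). g \<phi> \<theta>)" and bound: "\<And>\<phi> \<theta>. - c \<le> g \<phi> \<theta>"
  shows "0 < integral {0..2 * pi} (\<lambda>\<phi>. integral {0..pi} (\<lambda>\<theta>. exp (g \<phi> \<theta>) * sin \<theta>))"
proof -
  have cont: "continuous_on UNIV (\<lambda>(\<phi>, \<theta>). exp (g \<phi> \<theta>) * sin \<theta>)"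
    using g by (auto simp: case_prod_unfold intro!: continuous_intros)
  note gc = continuous_double_integral[OF cont]
  have sin: "((\<lambda>\<theta>. exp (- c) * sin \<theta>) has_integral exp (- c) * 2) {0..pi}"
    using has_integral_mult_right[OF has_integral_cos_sin_power[of 0 0], of "exp (- c)"] by simp
  have "exp (- c) * 2 \<le> integral {0..pi} (\<lambda>\<theta>. exp (g \<phi> \<theta>) * sin \<theta>)" for \<phi>
    by (rule has_integral_le[OF sin integrable_integral[OF integrable_continuous_real[OF gc(1)]]])
      (auto intro!: mult_right_mono bound sin_ge_zero)
  then have "integral {0..2 * pi} (\<lambda>_. exp (- c) * 2) \<le>
      integral {0..2 * pi} (\<lambda>\<phi>. integral {0..pi} (\<lambda>\<theta>. exp (g \<phi> \<theta>) * sin \<theta>))"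
    by (intro integral_le integrable_continuous_real gc continuous_on_const)
  moreover have "0 < integral {0..2 * pi} (\<lambda>_. exp (- c) * 2 :: real)" by simp
  ultimately show ?thesis by linarith
qed

text \<open>The additive constant \<open>- \<epsilon> / 2\<close> comes from \<open>m\<^sup>2 + n\<^sup>2 = (N\<^sup>2 + (m - n)\<^sup>2) / 2\<close>; it cancels in the
  normalization.\<close>

definition symbol :: "real \<Rightarrow> real \<Rightarrow> real \<Rightarrow> real \<Rightarrow> real" where
  "symbol \<delta> \<epsilon> \<theta> \<phi> = \<delta> * sin \<theta> * cos \<phi> - \<epsilon> / 2 * (cos \<theta>)\<^sup>2 - \<epsilon> / 2"

text \<open>The bound is the constant of \<open>bounded_scaled_hamiltonian\<close>, as
  \<open>op_exp_near_eigenvalue\<close> requires of \<open>h\<close>.\<close>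

lemma symbol_bound: "\<bar>symbol \<delta> \<epsilon> \<theta> \<phi>\<bar> \<le> 1 + 2 * \<bar>\<delta>\<bar> + \<bar>\<epsilon>\<bar>"
proof -
  have "\<bar>sin \<theta> * cos \<phi>\<bar> \<le> 1 * 1"
    unfolding abs_mult by (intro mult_mono) auto
  then have "\<bar>\<delta>\<bar> * \<bar>sin \<theta> * cos \<phi>\<bar> \<le> \<bar>\<delta>\<bar> * 1" by (intro mult_left_mono) auto
  then have 1: "\<bar>\<delta> * sin \<theta> * cos \<phi>\<bar> \<le> \<bar>\<delta>\<bar>" by (simp add: abs_mult mult.assoc)
  have "\<bar>\<epsilon> / 2\<bar> * (cos \<theta>)\<^sup>2 \<le> \<bar>\<epsilon> / 2\<bar> * 1" by (intro mult_left_mono) (auto simp: abs_square_le_1)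
  then have 2: "\<bar>\<epsilon> / 2 * (cos \<theta>)\<^sup>2\<bar> \<le> \<bar>\<epsilon> / 2\<bar>" by (simp add: abs_mult)
  show ?thesis unfolding symbol_def using 1 2 by (auto simp: abs_le_iff)
qed

lemma continuous_symbol: "continuous_on UNIV (\<lambda>(\<phi>, \<theta>). symbol \<delta> \<epsilon> \<theta> \<phi>)"
  unfolding symbol_def case_prod_unfold by (intro continuous_intros)

text \<open>The factor \<open>exp (2 * C)\<close> from the exponential series times the eigenvector
  error, uniform in both angles.\<close>

definition husimi_rate :: "real \<Rightarrow> real \<Rightarrow> nat \<Rightarrow> real" where
  "husimi_rate \<delta> \<epsilon> N = exp (2 * (1 + 2 * \<bar>\<delta>\<bar> + \<bar>\<epsilon>\<bar>)) * ((2 * \<bar>\<delta>\<bar> + 5 * \<bar>\<epsilon>\<bar>) / sqrt (real N))"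

lemma coherent_expectation_near_symbol:
  assumes N: "N \<ge> 1"
  shows "cmod (fock_inner (coherent_state N \<theta> \<phi>)
      (op_exp (scaled_hamiltonian N \<delta> \<epsilon>) (coherent_state N \<theta> \<phi>))
    - complex_of_real (exp (symbol \<delta> \<epsilon> \<theta> \<phi>))) \<le> husimi_rate \<delta> \<epsilon> N"
proof -
  interpret bounded_boson_op N "scaled_hamiltonian N \<delta> \<epsilon>" "1 + 2 * \<bar>\<delta>\<bar> + \<bar>\<epsilon>\<bar>"
    by (rule bounded_scaled_hamiltonian[OF N])
  define a where "a = cos (\<theta> / 2)"
  define b where "b = sin (\<theta> / 2)"
  define \<alpha> where "\<alpha> = complex_of_real a"
  define \<beta> where "\<beta> = exp (\<i> * complex_of_real \<phi>) * complex_of_real b"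
  have \<Psi>: "coherent_state N \<theta> \<phi> = coh N \<alpha> \<beta>"
    by (simp add: coherent_state_eq \<alpha>_def \<beta>_def a_def b_def)
  have ab: "a\<^sup>2 + b\<^sup>2 = 1" by (simp add: a_def b_def)
  have mods: "cmod \<alpha> = \<bar>a\<bar>" "cmod \<beta> = \<bar>b\<bar>" by (simp_all add: \<alpha>_def \<beta>_def norm_mult)
  have unit: "(cmod \<alpha>)\<^sup>2 + (cmod \<beta>)\<^sup>2 = 1" by (simp add: mods ab)
  have hop: "2 * Re (cnj \<alpha> * \<beta>) = sin \<theta> * cos \<phi>"
    using sin_double[of "\<theta> / 2"] by (simp add: \<alpha>_def \<beta>_def a_def b_def Re_exp)
  have cos: "cos \<theta> = a\<^sup>2 - b\<^sup>2" using cos_double[of "\<theta> / 2"] by (simp add: a_def b_def)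
  \<comment> \<open>Since a^2 + b^2 = 1, this rewrites the quartic part of the symbol through cos
    \<open>\<theta>\<close>.\<close>
  have "(a\<^sup>2 + b\<^sup>2)\<^sup>2 + (cos \<theta>)\<^sup>2 = 2 * (a ^ 4 + b ^ 4)"
    unfolding cos by (simp add: power2_eq_square algebra_simps power4_eq_xxxx)
  then have quartic: "(cmod \<alpha>) ^ 4 + (cmod \<beta>) ^ 4 = (1 + (cos \<theta>)\<^sup>2) / 2"
    by (simp add: mods ab)
  have h: "\<delta> * (2 * Re (cnj \<alpha> * \<beta>)) - \<epsilon> * ((cmod \<alpha>) ^ 4 + (cmod \<beta>) ^ 4) = symbol \<delta> \<epsilon> \<theta> \<phi>"
    unfolding hop quartic symbol_def by (simp add: algebra_simps)
  have "cmod (fock_inner (coh N \<alpha> \<beta>) (op_exp (scaled_hamiltonian N \<delta> \<epsilon>) (coh N \<alpha> \<beta>))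
      - exp (complex_of_real (symbol \<delta> \<epsilon> \<theta> \<phi>)))
    \<le> exp (2 * (1 + 2 * \<bar>\<delta>\<bar> + \<bar>\<epsilon>\<bar>)) * bnorm N (\<lambda>p. scaled_hamiltonian N \<delta> \<epsilon> (coh N \<alpha> \<beta>) p
        - complex_of_real (symbol \<delta> \<epsilon> \<theta> \<phi>) * coh N \<alpha> \<beta> p)"
    by (rule op_exp_near_eigenvalue) (simp_all add: bnorm_coh[OF unit] symbol_bound)
  also have "\<dots> \<le> husimi_rate \<delta> \<epsilon> N"
    unfolding husimi_rate_def
    by (intro mult_left_mono scaled_hamiltonian_near_symbol[OF N unit, of \<delta> \<epsilon>, unfolded h]) simp
  finally show ?thesis by (simp add: \<Psi> exp_of_real)
qed

lemma trace_near_partition_integral: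
  assumes N: "N \<ge> 1"
  shows "cmod (complex_of_real (4 * pi / real (N + 1)) * trace_on N (op_exp (scaled_hamiltonian N \<delta> \<epsilon>))
    - complex_of_real (integral {0..2 * pi} (\<lambda>\<phi>. integral {0..pi} (\<lambda>\<theta>. exp (symbol \<delta> \<epsilon> \<theta> \<phi>) * sin \<theta>))))
    \<le> husimi_rate \<delta> \<epsilon> N * pi * (2 * pi)"
proof -
  interpret bounded_boson_op N "scaled_hamiltonian N \<delta> \<epsilon>" "1 + 2 * \<bar>\<delta>\<bar> + \<bar>\<epsilon>\<bar>"
    by (rule bounded_scaled_hamiltonian[OF N])
  let ?G = "\<lambda>\<phi> \<theta>. fock_inner (coherent_state N \<theta> \<phi>)
      (op_exp (scaled_hamiltonian N \<delta> \<epsilon>) (coherent_state N \<theta> \<phi>))"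
  show ?thesis
  proof (rule double_integral_close[OF _ trace_op_exp_resolution])
    show "(\<lambda>\<theta>. ?G \<phi> \<theta> * complex_of_real (sin \<theta>)) integrable_on {0..pi}" for \<phi>
      using has_integral_inner_op_exp by (rule has_integral_integrable)
    show "continuous_on UNIV (\<lambda>(\<phi>, \<theta>). exp (symbol \<delta> \<epsilon> \<theta> \<phi>) * sin \<theta>)"
      using continuous_symbol[of \<delta> \<epsilon>] by (auto simp: case_prod_unfold intro!: continuous_intros)
    fix \<phi> \<theta>
    have "cmod (?G \<phi> \<theta> * complex_of_real (sin \<theta>) - complex_of_real (exp (symbol \<delta> \<epsilon> \<theta> \<phi>) * sin \<theta>))
        = cmod (?G \<phi> \<theta> - complex_of_real (exp (symbol \<delta> \<epsilon> \<theta> \<phi>))) * \<bar>sin \<theta>\<bar>"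
      by (simp only: of_real_mult left_diff_distrib[symmetric] norm_mult norm_of_real)
    also have "\<dots> \<le> husimi_rate \<delta> \<epsilon> N * 1"
      by (intro mult_mono coherent_expectation_near_symbol[OF N]) (auto simp: husimi_rate_def)
    finally show "cmod (?G \<phi> \<theta> * complex_of_real (sin \<theta>) - complex_of_real (exp (symbol \<delta> \<epsilon> \<theta> \<phi>) * sin \<theta>))
        \<le> husimi_rate \<delta> \<epsilon> N" by simp
  qed
qed

lemma husimi_rate_tendsto: "husimi_rate \<delta> \<epsilon> \<longlonglongrightarrow> 0"
proof -
  have "filterlim (\<lambda>N. sqrt (real N)) at_top sequentially"
    by (rule filterlim_compose[OF sqrt_at_top filterlim_real_sequentially])
  then show ?thesis
    unfolding husimi_rate_def
    by (intro tendsto_mult_right_zero tendsto_divide_0[OF tendsto_const] filterlim_at_top_imp_at_infinity)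
qed

theorem mainTheorem1:
  fixes kB \<delta> \<epsilon> \<theta> \<phi> :: real and J U T :: "nat \<Rightarrow> real"
  assumes "kB > 0"
    and "\<And>N. N \<ge> 1 \<Longrightarrow> T N > 0"
    and "\<And>N. N \<ge> 1 \<Longrightarrow> real N * J N / (kB * T N) = \<delta>"
    and "\<And>N. N \<ge> 1 \<Longrightarrow> (real N)\<^sup>2 * U N / (2 * kB * T N) = \<epsilon>"
    and "0 \<le> \<theta>" "\<theta> \<le> pi" "0 \<le> \<phi>" "\<phi> < 2 * pi"
  shows "(\<lambda>N. normalized_husimi kB N (J N) (U N) (T N) \<theta> \<phi>) \<longlonglongrightarrow>
    complex_of_real
      (exp (\<delta> * sin \<theta> * cos \<phi> - \<epsilon> / 2 * (cos \<theta>)\<^sup>2) /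
       integral {0..2 * pi} (\<lambda>\<phi>'. integral {0..pi} (\<lambda>\<theta>'.
         exp (\<delta> * sin \<theta>' * cos \<phi>' - \<epsilon> / 2 * (cos \<theta>')\<^sup>2) * sin \<theta>')))"
proof -
  define E where "E N = op_exp (scaled_hamiltonian N \<delta> \<epsilon>)" for N
  define G where "G N = fock_inner (coherent_state N \<theta> \<phi>) (E N (coherent_state N \<theta> \<phi>))" for N
  define Z where "Z = integral {0..2 * pi} (\<lambda>\<phi>. integral {0..pi} (\<lambda>\<theta>. exp (symbol \<delta> \<epsilon> \<theta> \<phi>) * sin \<theta>))"
  \<comment> \<open>The prefactor (N + 1) / (4 pi) of the normalized distribution is moved into the
    denominator, so that \<open>G\<close> and \<open>Tr\<close> have finite limits
    separately.\<close>
  define Tr where "Tr N = complex_of_real (4 * pi / real (N + 1)) * trace_on N (E N)" for N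
  have "G \<longlonglongrightarrow> complex_of_real (exp (symbol \<delta> \<epsilon> \<theta> \<phi>))"
    unfolding LIM_zero_iff[symmetric, of G]
    by (rule Lim_null_comparison[OF _ husimi_rate_tendsto])
      (auto simp: eventually_sequentially G_def E_def intro!: exI[of _ 1] coherent_expectation_near_symbol)
  moreover have "Tr \<longlonglongrightarrow> complex_of_real Z"
  proof -
    have "(\<lambda>N. husimi_rate \<delta> \<epsilon> N * (pi * (2 * pi))) \<longlonglongrightarrow> 0"
      by (rule tendsto_mult_left_zero[OF husimi_rate_tendsto])
    then have "(\<lambda>N. husimi_rate \<delta> \<epsilon> N * pi * (2 * pi)) \<longlonglongrightarrow> 0"
      by (simp only: mult.assoc)
    then have "(\<lambda>N. Tr N - complex_of_real Z) \<longlonglongrightarrow> 0"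
      by (rule Lim_null_comparison[rotated])
        (use trace_near_partition_integral in \<open>auto simp only: eventually_sequentially Tr_def E_def Z_def intro!: exI[of _ 1]\<close>)
    then show ?thesis by (rule LIM_zero_cancel)
  qed
  moreover have "Z > 0"
    unfolding Z_def
  proof (rule double_integral_exp_pos[OF continuous_symbol])
    show "- (1 + 2 * \<bar>\<delta>\<bar> + \<bar>\<epsilon>\<bar>) \<le> symbol \<delta> \<epsilon> \<theta> \<phi>" for \<phi> \<theta>
      using symbol_bound[of \<delta> \<epsilon> \<theta> \<phi>] by linarith
  qed
  ultimately have lim: "(\<lambda>N. G N / Tr N) \<longlonglongrightarrow> complex_of_real (exp (symbol \<delta> \<epsilon> \<theta> \<phi>)) / complex_of_real Z"
    by (intro tendsto_divide) auto
  have husimi: "normalized_husimi kB N (J N) (U N) (T N) \<theta> \<phi> = G N / Tr N" if N: "N \<ge> 1" for N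
  proof -
    have B: "boltzmann_op kB N (J N) (U N) (T N) \<psi> = E N \<psi>" if "\<psi> \<in> boson_space N" for \<psi>
      unfolding E_def by (rule boltzmann_op_scaled[OF N assms(3)[OF N] assms(4)[OF N] that])
    have \<Psi>: "coherent_state N \<theta> \<phi> \<in> boson_space N" by (simp add: coherent_state_eq)
    have "trace_on N (boltzmann_op kB N (J N) (U N) (T N)) = trace_on N (E N)"
      by (simp add: trace_on_def B)
    then have "husimi kB N (J N) (U N) (T N) \<theta> \<phi> = G N / trace_on N (E N)"
      by (simp add: husimi_def canonical_ensemble_def B[OF \<Psi>] G_def fock_inner_boson_space[OF \<Psi>] sum_divide_distrib)
    then show ?thesis by (simp add: normalized_husimi_def Tr_def)
  qed
  have "(\<lambda>N. normalized_husimi kB N (J N) (U N) (T N) \<theta> \<phi>) \<longlonglongrightarrow>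
      complex_of_real (exp (symbol \<delta> \<epsilon> \<theta> \<phi>)) / complex_of_real Z"
    by (rule Lim_transform_eventually[OF lim])
      (auto simp: eventually_sequentially husimi intro!: exI[of _ 1])
  moreover have "exp (symbol \<delta> \<epsilon> \<theta> \<phi>) / Z = exp (\<delta> * sin \<theta> * cos \<phi> - \<epsilon> / 2 * (cos \<theta>)\<^sup>2) /
       integral {0..2 * pi} (\<lambda>\<phi>'. integral {0..pi} (\<lambda>\<theta>'.
         exp (\<delta> * sin \<theta>' * cos \<phi>' - \<epsilon> / 2 * (cos \<theta>')\<^sup>2) * sin \<theta>'))"
  proof -
    have split: "exp (symbol \<delta> \<epsilon> \<theta> \<phi>) = exp (- \<epsilon> / 2) * exp (\<delta> * sin \<theta> * cos \<phi> - \<epsilon> / 2 * (cos \<theta>)\<^sup>2)" for \<theta> \<phi>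
      by (simp add: symbol_def flip: exp_add)
    show ?thesis unfolding Z_def split by (simp add: mult.assoc)
  qed
  ultimately show ?thesis by (simp flip: of_real_divide)
qed

end
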